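(* Let $d\ge1$ be an integer, let $\alpha>d$, and let $(\xi(z)\colon z\in\mathbb{Z}^d)$ be i.i.d. with $\mathrm{Prob}(\xi(z)\le x)=1-x^{-\alpha}$ for $x\ge1$. For $t>0$ let $Z_t\in\mathbb{Z}^d$ be the (almost surely unique) maximiser over $z\in\mathbb{Z}^d$ of $$\Psi_t(z)=\xi(z)-\frac{|z|}{t}\log\frac{|z|}{2det}\quad(z\neq0),\qquad \Psi_t(0)=\xi(0).$$ Put $$q=\frac{d}{\alpha-d},\qquad \mu=\frac{(\alpha-d)^d\,2^d\,B(\alpha-d,d)}{d^d\,(d-1)!}.$$ Then, as $t\to\infty$, $$Z_t\Big(\frac{\log t}{t}\Big)^{q+1}\Longrightarrow X,$$ where $X$ is an $\mathbb{R}^d$-valued random variable with Lebesgue density $$p(x)=\alpha\int_0^\infty\frac{\exp\{-\mu y^{d-\alpha}\}}{(y+q|x|)^{\alpha+1}}\,\mathrm{d}y .$$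
   Context: $|x|$ denotes the $\ell^1$-norm of $x\in\mathbb{R}^d$; $B(\cdot,\cdot)$ is the Beta function; $\Rightarrow$ denotes weak convergence (convergence in distribution); in $\log\frac{|z|}{2det}$ the denominator is the product $2\cdot d\cdot e\cdot t$ with $e$ Euler's number. For each fixed $t>0$, almost surely $\Psi_t$ attains its maximum over $\mathbb{Z}^d$ at exactly one point. *)

theory Defs
  imports "HOL-Probability.Probability"
begin

definition of_int_vec :: "int ^ 'n \<Rightarrow> real ^ 'n" where
  "of_int_vec z = (\<chi> i. real_of_int (z $ i))"

text \<open>The norm of \<^typ>\<open>real ^ 'n\<close> in the library is Euclidean, so the
  \<open>\<ell>\<^sup>1\<close>-norm is defined separately.\<close>

definition l1_norm :: "real ^ 'n \<Rightarrow> real" where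
  "l1_norm x = (\<Sum>i\<in>UNIV. \<bar>x $ i\<bar>)"

definition Psi :: "real \<Rightarrow> (int ^ 'n \<Rightarrow> real) \<Rightarrow> int ^ 'n \<Rightarrow> real" where
  "Psi t v z =
     (if z = 0 then v 0
      else v z - l1_norm (of_int_vec z) / t
                 * ln (l1_norm (of_int_vec z) / (2 * real CARD('n) * exp 1 * t)))"

definition q_const :: "nat \<Rightarrow> real \<Rightarrow> real" where
  "q_const d \<alpha> = real d / (\<alpha> - real d)"

definition mu_const :: "nat \<Rightarrow> real \<Rightarrow> real" where
  "mu_const d \<alpha> =
     (\<alpha> - real d) ^ d * 2 ^ d * Beta (\<alpha> - real d) (real d) / (real d ^ d * fact (d - 1))"

definition limit_density :: "real \<Rightarrow> real ^ 'n \<Rightarrow> real" where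
  "limit_density \<alpha> x =
     \<alpha> * (LBINT y:{0<..}. exp (- mu_const CARD('n) \<alpha> * y powr (real CARD('n) - \<alpha>))
                           / (y + q_const CARD('n) \<alpha> * l1_norm x) powr (\<alpha> + 1))"

text \<open>The library's \<^const>\<open>weak_conv_m\<close> covers only sequences of measures on the
  real line; here a continuous parameter and measures on \<open>\<real>\<^sup>d\<close> are needed.\<close>

definition weakly_converges ::
    "('t \<Rightarrow> 'a::topological_space measure) \<Rightarrow> 'a measure \<Rightarrow> 't filter \<Rightarrow> bool" where
  "weakly_converges P Q F \<longleftrightarrow>
     (\<forall>f :: 'a \<Rightarrow> real. continuous_on UNIV f \<longrightarrow> bounded (range f) \<longrightarrow>
        ((\<lambda>t. \<integral>x. f x \<partial>P t) \<longlongrightarrow> (\<integral>x. f x \<partial>Q)) F)"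

end

theory Submission
  imports Defs
begin

text \<open>Write \<open>a = (t / ln t) powr q\<close> and \<open>r = (t / ln t) powr (q + 1)\<close>, so that \<open>r ^ d = a powr \<alpha>\<close>.
Measured in units of \<open>a\<close>, the penalty of the site next to \<open>r *\<^sub>R x\<close> tends to \<open>q * l1_norm x\<close>: the
factor \<open>ln (r / t) / ln t\<close> tends to \<open>q\<close>. Hence the mean number of sites with
\<open>Psi t \<xi> z > a * y\<close>, a Riemann sum with cells of volume \<open>1 / r ^ d\<close>, tends to
\<open>\<integral> (y + q * l1_norm x) powr (-\<alpha>) dx = \<mu> * y powr (d - \<alpha>)\<close> (lemma \<open>level_intensity_tendsto\<close>), and by
independence no site exceeds the level with probability close to
\<open>exp (- \<mu> * y powr (d - \<alpha>))\<close>. For a site near \<open>r *\<^sub>R x\<close>, the value of \<open>Psi t \<xi>\<close> is near \<open>a * y\<close> with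
rescaled density \<open>\<alpha> * (y + q * l1_norm x) powr (-\<alpha> - 1)\<close>. The product of the last two
expressions is the joint limit density of position and height of the maximum; integrating
out the height \<open>y\<close> gives the density in the theorem.

No point process is needed to make this rigorous, because lower bounds suffice. Let
\<open>p\<^sub>t x\<close> be \<open>r ^ d\<close> times the probability that the maximiser is the lattice point
\<open>\<lfloor>r *\<^sub>R x\<rfloor>\<close>; it is a probability density. If the lower limit of \<open>p\<^sub>t\<close> is at least \<open>p\<close>
pointwise, Fatou's lemma bounds the lower limit of the expectation of every nonnegative continuous
function from below by its integral against \<open>p\<close>. Since \<open>p\<close> has mass one, applying this
to \<open>B + 1 + f\<close> and \<open>B + 1 - f\<close> for \<open>f\<close> bounded by \<open>B\<close> yields convergence.

The pointwise lower bound rests on three ingredients. First, if exactly the site \<open>z\<close> exceeds the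
level \<open>a * y\<close>, then \<open>z\<close> is the maximiser; averaging over the levels \<open>y\<close> with
\<open>a * y < Psi t \<xi> z \<le> a * (y + \<delta>)\<close> turns this into an integral over \<open>y\<close> (lemma
\<open>nn_integral_isolated_le_prob_maximiser\<close>), to which Fatou's lemma applies with \<open>\<delta> \<rightarrow> 0\<close>.
Second, \<open>1 - p \<ge> exp (- p / (1 - \<epsilon>))\<close> for \<open>p \<le> \<epsilon>\<close> bounds the product of the one-site probabilities
from below through the sum of the tails alone (lemma \<open>prob_isolated_ge\<close>). Third, that
sum converges by dominated convergence. The radial integrals are
computed by writing a power as a Gamma integral, after which the integral over space factorises.\<close>

section \<open>The l1 norm\<close>

lemma l1_norm_nonneg [simp]: "0 \<le> l1_norm x"
  by (simp add: l1_norm_def sum_nonneg)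

lemma borel_measurable_l1_norm [measurable]: "l1_norm \<in> borel_measurable borel"
  unfolding l1_norm_def by measurable

lemma l1_norm_triangle: "l1_norm (x + y) \<le> l1_norm x + l1_norm y"
  by (simp add: l1_norm_def flip: sum.distrib) (intro sum_mono abs_triangle_ineq)

lemma l1_norm_scaleR: "l1_norm (c *\<^sub>R x) = \<bar>c\<bar> * l1_norm x"
  by (simp add: l1_norm_def abs_mult sum_distrib_left)

lemma l1_norm_eq_0_iff: "l1_norm x = 0 \<longleftrightarrow> x = 0"
  by (simp add: l1_norm_def sum_nonneg_eq_0_iff vec_eq_iff)

lemma continuous_on_l1_norm [continuous_intros]:
  "continuous_on S f \<Longrightarrow> continuous_on S (\<lambda>x. l1_norm (f x))"
  unfolding l1_norm_def by (intro continuous_intros)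

section \<open>A radial integral over Euclidean space\<close>

text \<open>Read from right to left, this represents the power \<open>s powr (-\<beta>)\<close> as a mixture of exponentials
  in \<open>s\<close>.\<close>

lemma nn_integral_powr_times_exp:
  fixes \<beta> s :: real
  assumes "0 < \<beta>" "0 < s"
  shows "(\<integral>\<^sup>+u\<in>{0<..}. ennreal (u powr (\<beta> - 1) * exp (- s * u)) \<partial>lborel)
    = ennreal (Gamma \<beta> * s powr (- \<beta>))"
proof -
  have "(\<integral>\<^sup>+u\<in>{0<..}. ennreal (u powr (\<beta> - 1) * exp (- s * u)) \<partial>lborel)
     = ennreal \<bar>1 / s\<bar> * (\<integral>\<^sup>+v. ennreal ((v / s) powr (\<beta> - 1) * exp (- v)) * indicator {0<..} (v / s) \<partial>lborel)"
    using assms by (subst nn_integral_real_affine[where c = "1 / s" and t = 0]) (auto simp: field_simps)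
  also have "(\<integral>\<^sup>+v. ennreal ((v / s) powr (\<beta> - 1) * exp (- v)) * indicator {0<..} (v / s) \<partial>lborel)
     = (\<integral>\<^sup>+v. ennreal (s powr (1 - \<beta>)) * ennreal (indicator {0..} v * v powr (\<beta> - 1) / exp v) \<partial>lborel)"
    using assms AE_lborel_singleton[of "0::real"]
    by (intro nn_integral_cong_AE)
       (auto simp: indicator_def zero_less_divide_iff powr_divide exp_minus powr_minus powr_diff field_simps
         simp flip: ennreal_mult elim!: eventually_mono)
  also have "\<dots> = ennreal (s powr (1 - \<beta>)) * ennreal (Gamma \<beta>)"
    using assms by (subst nn_integral_cmult) (auto simp: Gamma_conv_nn_integral_real)
  also have "ennreal \<bar>1 / s\<bar> * \<dots> = ennreal (Gamma \<beta> * s powr (- \<beta>))"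
    using assms by (simp add: Gamma_real_pos less_imp_le powr_diff powr_minus field_simps flip: ennreal_mult)
  finally show ?thesis .
qed

lemma nn_integral_exp_abs:
  fixes s :: real
  assumes "0 < s"
  shows "(\<integral>\<^sup>+x. ennreal (exp (- s * \<bar>x\<bar>)) \<partial>lborel) = ennreal (2 / s)"
proof -
  have half: "(\<integral>\<^sup>+x\<in>{0<..}. ennreal (exp (- s * x)) \<partial>lborel) = ennreal (1 / s)"
  proof -
    have "(\<integral>\<^sup>+x\<in>{0<..}. ennreal (exp (- s * x)) \<partial>lborel)
        = (\<integral>\<^sup>+u\<in>{0<..}. ennreal (u powr (1 - 1) * exp (- s * u)) \<partial>lborel)"
      by (intro nn_integral_cong) (auto simp: indicator_def)
    also have "\<dots> = ennreal (1 / s)"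
      using assms by (subst nn_integral_powr_times_exp) (auto simp: powr_minus field_simps)
    finally show ?thesis .
  qed
  have "(\<integral>\<^sup>+x. ennreal (exp (- s * \<bar>x\<bar>)) \<partial>lborel)
      = (\<integral>\<^sup>+x. ennreal (exp (- s * x)) * indicator {0<..} x
            + ennreal (exp (- s * - x)) * indicator {0<..} (- x) \<partial>lborel)"
    using AE_lborel_singleton[of "0::real"]
    by (intro nn_integral_cong_AE) (auto simp: indicator_def elim!: eventually_mono)
  also have "\<dots> = ennreal (1 / s) + (\<integral>\<^sup>+x. ennreal (exp (- s * - x)) * indicator {0<..} (- x) \<partial>lborel)"
    by (subst nn_integral_add) (auto simp: half[simplified])
  also have "(\<integral>\<^sup>+x. ennreal (exp (- s * - x)) * indicator {0<..} (- x) \<partial>lborel) = ennreal (1 / s)"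
    using half nn_integral_real_affine[of "\<lambda>x. ennreal (exp (- s * x)) * indicator {0<..} x" "-1" 0]
    by simp
  finally show ?thesis
    using assms by (simp flip: ennreal_plus)
qed

text \<open>An exponential of the \<open>\<ell>\<^sup>1\<close> norm is a product over the coordinates, so its integral is the
  \<open>d\<close>-th power of a one-dimensional one.\<close>

lemma nn_integral_exp_l1_norm:
  fixes s :: real
  assumes "0 < s"
  shows "(\<integral>\<^sup>+x. ennreal (exp (- s * l1_norm (x::real^'n))) \<partial>lborel) = ennreal ((2 / s) ^ CARD('n))"
proof -
  have "exp (- s * l1_norm x) = (\<Prod>b\<in>Basis. exp (- s * \<bar>x \<bullet> b\<bar>))" for x :: "real^'n"
  proof -
    have B: "(Basis :: (real^'n) set) = (\<lambda>i. axis i 1) ` UNIV"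
      by (auto simp: Basis_vec_def)
    have I: "inj (\<lambda>i::'n. axis i (1::real))"
      by (auto simp: inj_on_def axis_eq_axis)
    have "(\<Prod>b\<in>Basis. exp (- s * \<bar>x \<bullet> b\<bar>)) = (\<Prod>i\<in>UNIV. exp (- s * \<bar>x $ i\<bar>))"
      by (simp only: B prod.reindex[OF I]) (simp add: inner_axis)
    then show ?thesis
      by (simp add: l1_norm_def sum_distrib_left exp_sum flip: sum_negf)
  qed
  then have "(\<integral>\<^sup>+x. ennreal (exp (- s * l1_norm (x::real^'n))) \<partial>lborel)
    = (\<integral>\<^sup>+x. (\<Prod>b\<in>Basis. ennreal (exp (- s * \<bar>(x::real^'n) \<bullet> b\<bar>))) \<partial>lborel)"
    by (simp add: prod_ennreal)
  also have "\<dots> = (\<Prod>b\<in>(Basis::(real^'n) set). ennreal (2 / s))"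
    by (subst nn_integral_lborel_prod) (simp_all only: nn_integral_exp_abs[OF assms], auto)
  also have "\<dots> = ennreal ((2 / s) ^ CARD('n))"
    using assms by (simp add: ennreal_power)
  finally show ?thesis .
qed

text \<open>The power of \<open>y + q * l1_norm x\<close> is written as a Gamma integral in an auxiliary variable \<open>u\<close>. After
  exchanging the integrals, the integral over \<open>x\<close> is that of an exponential, and the remaining integral over
  \<open>u\<close> is again a Gamma integral, with exponent lowered by the dimension. This avoids
  polar coordinates for the \<open>\<ell>\<^sup>1\<close> norm.\<close>

proposition nn_integral_l1_norm_powr:
  fixes \<beta> q y :: real
  assumes "real CARD('n) < \<beta>" "0 < q" "0 < y"
  shows "(\<integral>\<^sup>+x. ennreal ((y + q * l1_norm (x::real^'n)) powr (- \<beta>)) \<partial>lborel)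
    = ennreal ((2 / q) ^ CARD('n) * Gamma (\<beta> - CARD('n)) / Gamma \<beta> * y powr (CARD('n) - \<beta>))"
proof -
  let ?d = "CARD('n)"
  have \<beta>: "0 < \<beta>" using assms(1) by linarith
  have G: "0 < Gamma \<beta>" "0 < Gamma (\<beta> - ?d)"
    using \<beta> assms(1) by (auto intro: Gamma_real_pos)
  have "ennreal (Gamma \<beta>) * (\<integral>\<^sup>+x. ennreal ((y + q * l1_norm (x::real^'n)) powr (- \<beta>)) \<partial>lborel)
    = (\<integral>\<^sup>+x. ennreal (Gamma \<beta> * (y + q * l1_norm (x::real^'n)) powr (- \<beta>)) \<partial>lborel)"
    using G by (subst nn_integral_cmult[symmetric]) (auto simp: ennreal_mult)
  also have "\<dots> = (\<integral>\<^sup>+x. (\<integral>\<^sup>+u\<in>{0<..}. ennreal (u powr (\<beta> - 1) * exp (- (y + q * l1_norm (x::real^'n)) * u)) \<partial>lborel) \<partial>lborel)"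
    using assms \<beta> by (intro nn_integral_cong, subst nn_integral_powr_times_exp) (auto intro: add_pos_nonneg)
  also have "\<dots> = (\<integral>\<^sup>+u\<in>{0<..}. (\<integral>\<^sup>+x. ennreal (u powr (\<beta> - 1) * exp (- (y + q * l1_norm (x::real^'n)) * u)) \<partial>lborel) \<partial>lborel)"
    by (subst lborel_pair.Fubini') (auto simp: nn_integral_multc)
  also have "\<dots> = (\<integral>\<^sup>+u\<in>{0<..}. ennreal ((2 / q) ^ ?d) * ennreal (u powr (\<beta> - ?d - 1) * exp (- y * u)) \<partial>lborel)"
  proof (intro nn_integral_cong)
    fix u :: real
    show "(\<integral>\<^sup>+x. ennreal (u powr (\<beta> - 1) * exp (- (y + q * l1_norm (x::real^'n)) * u)) \<partial>lborel) * indicator {0<..} u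
      = ennreal ((2 / q) ^ ?d) * ennreal (u powr (\<beta> - ?d - 1) * exp (- y * u)) * indicator {0<..} u"
    proof (cases "0 < u")
      case True
      have "(\<integral>\<^sup>+x. ennreal (u powr (\<beta> - 1) * exp (- (y + q * l1_norm (x::real^'n)) * u)) \<partial>lborel)
        = (\<integral>\<^sup>+x. ennreal (u powr (\<beta> - 1) * exp (- y * u)) * ennreal (exp (- (q * u) * l1_norm (x::real^'n))) \<partial>lborel)"
        by (intro nn_integral_cong) (simp add: algebra_simps exp_diff exp_minus divide_inverse flip: ennreal_mult)
      also have "\<dots> = ennreal (u powr (\<beta> - 1) * exp (- y * u)) * ennreal ((2 / (q * u)) ^ ?d)"
        using True assms by (subst nn_integral_cmult, measurable) (subst nn_integral_exp_l1_norm, auto)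
      also have "\<dots> = ennreal ((2 / q) ^ ?d) * ennreal (u powr (\<beta> - ?d - 1) * exp (- y * u))"
      proof -
        have "u powr (\<beta> - 1) = u powr (\<beta> - ?d - 1) * u ^ ?d"
          using True by (simp flip: powr_realpow powr_add)
        with True assms show ?thesis
          by (simp add: power_divide power_mult_distrib mult_ac flip: ennreal_mult)
      qed
      finally show ?thesis by simp
    qed simp
  qed
  also have "\<dots> = ennreal ((2 / q) ^ ?d) * ennreal (Gamma (\<beta> - ?d) * y powr (- (\<beta> - ?d)))"
    using assms by (subst nn_integral_powr_times_exp[symmetric])
       (auto simp: mult.assoc nn_integral_cmult)
  finally have "ennreal (Gamma \<beta>) * (\<integral>\<^sup>+x. ennreal ((y + q * l1_norm (x::real^'n)) powr (- \<beta>)) \<partial>lborel)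
     = ennreal (Gamma \<beta>) * ennreal ((2 / q) ^ ?d * Gamma (\<beta> - ?d) / Gamma \<beta> * y powr (?d - \<beta>))"
    using assms G less_imp_neq[OF G(1), symmetric] by (simp flip: ennreal_mult)
  then show ?thesis
    using G by (subst (asm) ennreal_mult_cancel_left) auto
qed

section \<open>The constants\<close>

text \<open>In this form \<open>\<mu>\<close> is recognised as the constant of the radial integral with exponent \<open>\<alpha>\<close>:
  the factor \<open>\<Gamma> d\<close> of the Beta function cancels against \<open>(d - 1)!\<close>.\<close>

lemma mu_const_eq_Gamma:
  assumes "real d < \<alpha>" "0 < d"
  shows "mu_const d \<alpha> = (2 / q_const d \<alpha>) ^ d * Gamma (\<alpha> - d) / Gamma \<alpha>"
proof -
  have 1: "Gamma (real d) = fact (d - 1)"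
    using assms(2) Gamma_fact[of "d - 1", where 'a = real] by (simp add: of_nat_diff)
  have 2: "(2 / q_const d \<alpha>) ^ d = 2 ^ d * (\<alpha> - d) ^ d / d ^ d"
    by (simp add: q_const_def flip: power_divide power_mult_distrib)
  show ?thesis
    unfolding mu_const_def Beta_def 1 2 by (simp add: mult_ac)
qed

lemma mu_const_pos:
  assumes "real d < \<alpha>" "0 < d"
  shows "0 < mu_const d \<alpha>"
  using assms by (subst mu_const_eq_Gamma) (auto simp: q_const_def intro!: divide_pos_pos mult_pos_pos Gamma_real_pos)

lemma q_const_pos: "real d < \<alpha> \<Longrightarrow> 0 < d \<Longrightarrow> 0 < q_const d \<alpha>"
  by (simp add: q_const_def)

section \<open>Lattice cells\<close>

text \<open>The corner with the least coordinates of the unit cell containing \<open>r *\<^sub>R x\<close>. Composing with this map turns a function on the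
  lattice into a step function on space, and thus sums over sites into Lebesgue integrals.\<close>

definition lattice_floor :: "real \<Rightarrow> real ^ 'n \<Rightarrow> int ^ 'n" where
  "lattice_floor r x = (\<chi> i. \<lfloor>r * x $ i\<rfloor>)"

lemma lattice_floor_eq_iff:
  "lattice_floor r x = z \<longleftrightarrow> (\<forall>i. real_of_int (z $ i) \<le> r * x $ i \<and> r * x $ i < real_of_int (z $ i) + 1)"
  by (simp add: lattice_floor_def vec_eq_iff floor_eq_iff)

lemma measurable_lattice_floor [measurable]:
  "lattice_floor r \<in> borel \<rightarrow>\<^sub>M count_space (UNIV :: (int^'n) set)"
proof -
  have "lattice_floor r -` {z} \<inter> space borel \<in> sets borel" for z :: "int^'n"
  proof -
    have "lattice_floor r -` {z} \<inter> space borel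
        = {x \<in> space borel. \<forall>i. real_of_int (z $ i) \<le> r * x $ i \<and> r * x $ i < real_of_int (z $ i) + 1}"
      unfolding lattice_floor_eq_iff[symmetric] by auto
    also have "\<dots> \<in> sets borel" by measurable
    finally show ?thesis .
  qed
  then show ?thesis
    by (subst measurable_count_space_eq_countable) (auto intro: countableI_type)
qed

lemma emeasure_lattice_cell:
  fixes z :: "int^'n"
  assumes "0 < r"
  shows "emeasure lborel {x. lattice_floor r x = z} = ennreal (1 / r ^ CARD('n))"
proof -
  define a b :: "real^'n" where "a = (\<chi> i. z $ i / r)" and "b = (\<chi> i. (z $ i + 1) / r)"
  have ab: "(b - a) \<bullet> v = 1 / r" if "v \<in> Basis" for v
    using that assms by (auto simp: Basis_vec_def a_def b_def inner_axis add_divide_distrib)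
  have le: "a \<bullet> v \<le> b \<bullet> v" if "v \<in> Basis" for v
  proof -
    have "0 \<le> (b - a) \<bullet> v" unfolding ab[OF that] using assms by simp
    then show ?thesis by (simp add: inner_diff_left)
  qed
  have vol: "ennreal (\<Prod>v\<in>Basis. (b - a) \<bullet> v) = ennreal (1 / r ^ CARD('n))"
    by (simp add: ab power_divide cong: prod.cong)
  have sub: "box a b \<subseteq> {x. lattice_floor r x = z}" "{x. lattice_floor r x = z} \<subseteq> cbox a b"
    using assms by (auto simp: lattice_floor_eq_iff mem_box_cart a_def b_def field_simps less_imp_le)
  have cell: "{x. lattice_floor r x = z} \<in> sets lborel"
    by measurable
  show ?thesis
  proof (rule antisym)
    show "emeasure lborel {x. lattice_floor r x = z} \<le> ennreal (1 / r ^ CARD('n))"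
      using emeasure_mono[OF sub(2), of lborel] le vol by simp
    show "ennreal (1 / r ^ CARD('n)) \<le> emeasure lborel {x. lattice_floor r x = z}"
      using emeasure_mono[OF sub(1) cell] le vol by simp
  qed
qed

lemma nn_integral_lattice_floor:
  fixes h :: "int^'n \<Rightarrow> ennreal"
  assumes "0 < r"
  shows "(\<integral>\<^sup>+x. h (lattice_floor r x) \<partial>lborel)
    = ennreal (1 / r ^ CARD('n)) * (\<integral>\<^sup>+z. h z \<partial>count_space UNIV)"
proof -
  have "distr lborel (count_space UNIV) (lattice_floor r)
      = density (count_space (UNIV :: (int^'n) set)) (\<lambda>_. ennreal (1 / r ^ CARD('n)))"
  proof (rule measure_eqI_countable[where A = UNIV])
    fix z :: "int^'n"
    have "lattice_floor r -` {z} = {x. lattice_floor r x = z}" by auto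
    then show "emeasure (distr lborel (count_space UNIV) (lattice_floor r)) {z}
        = emeasure (density (count_space UNIV) (\<lambda>_. ennreal (1 / r ^ CARD('n)))) {z}"
      using assms by (subst emeasure_distr) (auto simp: emeasure_lattice_cell emeasure_density nn_integral_cmult)
  qed (auto intro: countableI_type)
  then have "(\<integral>\<^sup>+z. h z \<partial>distr lborel (count_space UNIV) (lattice_floor r))
     = (\<integral>\<^sup>+z. h z \<partial>density (count_space UNIV) (\<lambda>_. ennreal (1 / r ^ CARD('n))))"
    by simp
  then show ?thesis
    by (subst (asm) nn_integral_distr) (auto simp: nn_integral_density nn_integral_cmult)
qed

section \<open>The limit density\<close>

text \<open>The integrand is the derivative of \<open>exp (- m * y powr (-b))\<close>, the distribution function of a Frechet law;
  in the limit theorem it is the density of the rescaled height of the maximum.\<close>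

lemma nn_integral_frechet_density:
  fixes m b :: real
  assumes "0 < m" "0 < b"
  shows "(\<integral>\<^sup>+y\<in>{0<..}. ennreal (m * b * y powr (- b - 1) * exp (- m * y powr (- b))) \<partial>lborel) = 1"
proof -
  let ?f = "\<lambda>y. m * b * y powr (- b - 1) * exp (- m * y powr (- b))"
  let ?F = "\<lambda>y. exp (- m * y powr (- b))"
  have nonneg: "0 \<le> ?f y" for y using assms by simp
  have D: "(?F has_real_derivative ?f x) (at x)" if "0 < x" for x
    using that by (auto intro!: derivative_eq_intros simp: field_simps)
  have C: "isCont ?f x" if "0 < x" for x
    using that by (intro continuous_intros) auto
  have 0: "(?F \<longlongrightarrow> 0) (at_right 0)"
    using assms by real_asymp
  have 1: "(?F \<longlongrightarrow> 1) at_top"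
    using assms by real_asymp
  have einterval: "einterval 0 \<infinity> = {0<..}"
    by (auto simp: einterval_def zero_ereal_def)
  note FTC = interval_integral_FTC_nonneg[where a = 0 and b = \<infinity> and F = ?F and f = ?f and A = 0 and B = 1]
  have "set_integrable lborel (einterval 0 \<infinity>) ?f" "(LBINT x=0..\<infinity>. ?f x) = 1 - 0"
    by (rule FTC; use 0 1 D C nonneg in \<open>auto simp: zero_ereal_def ereal_tendsto_simps simp del: ereal_eq_0\<close>)+
  then have "set_integrable lborel {0<..} ?f" "(LBINT x:{0<..}. ?f x) = 1"
    by (simp_all add: einterval interval_lebesgue_integral_def)
  then have "(\<integral>\<^sup>+y. ennreal (indicator {0<..} y * ?f y) \<partial>lborel) = ennreal 1"
    unfolding set_integrable_def set_lebesgue_integral_def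
    by (subst nn_integral_eq_integral) (use nonneg in auto)
  moreover have "(\<integral>\<^sup>+y. ennreal (indicator {0<..} y * ?f y) \<partial>lborel) = (\<integral>\<^sup>+y\<in>{0<..}. ennreal (?f y) \<partial>lborel)"
    by (intro nn_integral_cong) (auto simp: indicator_def)
  ultimately show ?thesis by simp
qed

text \<open>The limiting joint density of the rescaled position \<open>x\<close> and the rescaled height \<open>y\<close> of the maximum: some site near
  \<open>x\<close> has height \<open>y\<close>, and no other site is higher.\<close>

definition joint_density :: "real \<Rightarrow> real ^ 'n \<Rightarrow> real \<Rightarrow> real" where
  "joint_density \<alpha> x y =
     \<alpha> * (exp (- mu_const CARD('n) \<alpha> * y powr (real CARD('n) - \<alpha>))
          * (y + q_const CARD('n) \<alpha> * l1_norm x) powr (- (\<alpha> + 1)))"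

lemma measurable_joint_density_pair [measurable]:
  "(\<lambda>(x :: real^'n, y). joint_density \<alpha> x y) \<in> borel_measurable (borel \<Otimes>\<^sub>M borel)"
  unfolding joint_density_def by measurable

lemma measurable_joint_density [measurable]:
  "joint_density \<alpha> (x :: real^'n) \<in> borel_measurable borel"
  unfolding joint_density_def by measurable

lemma joint_density_nonneg: "0 \<le> \<alpha> \<Longrightarrow> 0 \<le> joint_density \<alpha> x y"
  by (simp add: joint_density_def)

text \<open>Integrating out the position first leaves the Frechet density of the height, whose mass is one.\<close>

lemma nn_integral_joint_density:
  fixes \<alpha> :: real
  assumes "real CARD('n) < \<alpha>"
  shows "(\<integral>\<^sup>+x. (\<integral>\<^sup>+y\<in>{0<..}. ennreal (joint_density \<alpha> (x :: real^'n) y) \<partial>lborel) \<partial>lborel) = 1"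
proof -
  let ?d = "CARD('n)" and ?q = "q_const CARD('n) \<alpha>" and ?\<mu> = "mu_const CARD('n) \<alpha>"
  have \<alpha>: "0 < \<alpha>" using assms by linarith
  have q: "0 < ?q" and \<mu>: "0 < ?\<mu>" using assms by (auto intro: q_const_pos mu_const_pos)
  have "(\<integral>\<^sup>+x. (\<integral>\<^sup>+y\<in>{0<..}. ennreal (joint_density \<alpha> (x :: real^'n) y) \<partial>lborel) \<partial>lborel)
    = (\<integral>\<^sup>+y\<in>{0<..}. (\<integral>\<^sup>+x. ennreal (joint_density \<alpha> (x :: real^'n) y) \<partial>lborel) \<partial>lborel)"
    by (subst lborel_pair.Fubini') (auto simp: nn_integral_multc)
  also have "\<dots> = (\<integral>\<^sup>+y\<in>{0<..}. ennreal (?\<mu> * (\<alpha> - ?d) * y powr (- (\<alpha> - ?d) - 1) * exp (- ?\<mu> * y powr (- (\<alpha> - ?d)))) \<partial>lborel)"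
  proof (intro nn_integral_cong)
    fix y :: real
    show "(\<integral>\<^sup>+x. ennreal (joint_density \<alpha> (x :: real^'n) y) \<partial>lborel) * indicator {0<..} y
      = ennreal (?\<mu> * (\<alpha> - ?d) * y powr (- (\<alpha> - ?d) - 1) * exp (- ?\<mu> * y powr (- (\<alpha> - ?d)))) * indicator {0<..} y"
    proof (cases "0 < y")
      case True
      let ?e = "exp (- ?\<mu> * y powr (?d - \<alpha>))"
      have "(\<integral>\<^sup>+x. ennreal (joint_density \<alpha> (x :: real^'n) y) \<partial>lborel)
        = ennreal (\<alpha> * ?e) * (\<integral>\<^sup>+x. ennreal ((y + ?q * l1_norm (x :: real^'n)) powr (- (\<alpha> + 1))) \<partial>lborel)"
        using \<alpha> by (subst nn_integral_cmult[symmetric])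
          (auto intro!: nn_integral_cong simp: joint_density_def mult.assoc simp flip: ennreal_mult)
      also have "\<dots> = ennreal (\<alpha> * ?e) *
          ennreal ((2 / ?q) ^ ?d * Gamma (\<alpha> + 1 - ?d) / Gamma (\<alpha> + 1) * y powr (?d - (\<alpha> + 1)))"
        using assms q True by (subst nn_integral_l1_norm_powr) auto
      also have "(2 / ?q) ^ ?d * Gamma (\<alpha> + 1 - ?d) / Gamma (\<alpha> + 1) = ?\<mu> * (\<alpha> - ?d) / \<alpha>"
      proof -
        have 1: "Gamma (\<alpha> + 1) = \<alpha> * Gamma \<alpha>"
          using \<alpha> by (intro Gamma_plus1) (auto elim!: nonpos_Ints_cases)
        have 2: "Gamma (\<alpha> - ?d + 1) = (\<alpha> - ?d) * Gamma (\<alpha> - ?d)"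
          using assms by (intro Gamma_plus1) (auto elim!: nonpos_Ints_cases)
        have 3: "\<alpha> + 1 - ?d = \<alpha> - ?d + 1" by simp
        show ?thesis
          unfolding mu_const_eq_Gamma[OF assms zero_less_card_finite] 1 2 3 by (simp add: mult_ac)
      qed
      also have "ennreal (\<alpha> * ?e) * ennreal (?\<mu> * (\<alpha> - ?d) / \<alpha> * y powr (?d - (\<alpha> + 1)))
        = ennreal (?\<mu> * (\<alpha> - ?d) * y powr (- (\<alpha> - ?d) - 1) * exp (- ?\<mu> * y powr (- (\<alpha> - ?d))))"
      proof -
        have eqs: "?d - (\<alpha> + 1) = - (\<alpha> - ?d) - 1" "?d - \<alpha> = - (\<alpha> - ?d)" by auto
        have "\<alpha> * e * (m * b / \<alpha> * p) = m * b * p * e" for e m b p :: real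
          using \<alpha> by simp
        moreover have "0 \<le> \<alpha> * ?e" using \<alpha> by simp
        ultimately show ?thesis
          by (simp only: eqs flip: ennreal_mult')
      qed
      finally show ?thesis by simp
    qed simp
  qed
  also have "\<dots> = 1"
    using assms \<mu> by (intro nn_integral_frechet_density) auto
  finally show ?thesis .
qed

lemma limit_density_conv_nn_integral:
  fixes \<alpha> :: real and x :: "real^'n"
  assumes "real CARD('n) < \<alpha>"
  shows "limit_density \<alpha> x = enn2real (\<integral>\<^sup>+y\<in>{0<..}. ennreal (joint_density \<alpha> x y) \<partial>lborel)"
proof -
  have \<alpha>: "0 < \<alpha>" using assms by linarith
  have "limit_density \<alpha> x = (LBINT y:{0<..}. joint_density \<alpha> x y)"
    unfolding limit_density_def joint_density_def set_integral_mult_right powr_minus_divide by simp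
  also have "\<dots> = enn2real (\<integral>\<^sup>+y. ennreal (indicator {0<..} y * joint_density \<alpha> x y) \<partial>lborel)"
    unfolding set_lebesgue_integral_def using \<alpha>
    by (subst integral_eq_nn_integral) (auto simp: joint_density_nonneg)
  also have "(\<integral>\<^sup>+y. ennreal (indicator {0<..} y * joint_density \<alpha> x y) \<partial>lborel)
    = (\<integral>\<^sup>+y\<in>{0<..}. ennreal (joint_density \<alpha> x y) \<partial>lborel)"
    by (intro nn_integral_cong) (auto simp: indicator_def)
  finally show ?thesis .
qed

text \<open>The Bochner integral in the definition of the limit density would be zero where the nonnegative integral
  is infinite; as the latter has finite total mass, this concerns a null set only.\<close>

lemma AE_limit_density:
  fixes \<alpha> :: real
  assumes "real CARD('n) < \<alpha>"
  shows "AE x :: real^'n in lborel.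
    ennreal (limit_density \<alpha> x) = (\<integral>\<^sup>+y\<in>{0<..}. ennreal (joint_density \<alpha> x y) \<partial>lborel)"
proof -
  have "AE x :: real^'n in lborel. (\<integral>\<^sup>+y\<in>{0<..}. ennreal (joint_density \<alpha> x y) \<partial>lborel) \<noteq> \<infinity>"
    by (rule nn_integral_noteq_infinite) (use nn_integral_joint_density[OF assms] in auto)
  then show ?thesis
    by eventually_elim (simp add: limit_density_conv_nn_integral[OF assms] less_top[symmetric])
qed

lemma measurable_limit_density [measurable]:
  "limit_density \<alpha> \<in> borel_measurable (borel :: (real^'n) measure)"
  unfolding limit_density_def set_lebesgue_integral_def by measurable

lemma prob_space_limit_density:
  fixes \<alpha> :: real
  assumes "real CARD('n) < \<alpha>"
  shows "prob_space (density lborel (\<lambda>x :: real ^ 'n. ennreal (limit_density \<alpha> x)))"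
proof
  have "(\<integral>\<^sup>+x. ennreal (limit_density \<alpha> (x :: real^'n)) \<partial>lborel) = 1"
    using nn_integral_cong_AE[OF AE_limit_density[OF assms]] nn_integral_joint_density[OF assms] by simp
  then show "emeasure (density lborel (\<lambda>x :: real ^ 'n. ennreal (limit_density \<alpha> x)))
      (space (density lborel (\<lambda>x :: real ^ 'n. ennreal (limit_density \<alpha> x)))) = 1"
    by (subst emeasure_density) auto
qed

section \<open>The penalty on the limiting scales\<close>

definition penalty :: "real \<Rightarrow> int ^ 'n \<Rightarrow> real" where
  "penalty t z = l1_norm (of_int_vec z) / t
     * ln (l1_norm (of_int_vec z) / (2 * real CARD('n) * exp 1 * t))"

lemma Psi_eq_diff_penalty: "Psi t v z = v z - penalty t z"
  by (simp add: Psi_def penalty_def l1_norm_def of_int_vec_def)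

definition height_scale :: "real \<Rightarrow> real \<Rightarrow> real" where
  "height_scale q t = (t / ln t) powr q"

definition space_scale :: "real \<Rightarrow> real \<Rightarrow> real" where
  "space_scale q t = (t / ln t) powr (q + 1)"

text \<open>The penalty in units of the height scale, as a function of the distance \<open>s\<close> from the origin in
  units of the space scale; \<open>d\<close> is the dimension.\<close>

definition scaled_penalty :: "nat \<Rightarrow> real \<Rightarrow> real \<Rightarrow> real \<Rightarrow> real" where
  "scaled_penalty d q t s = s * (ln (s * space_scale q t / (2 * real d * exp 1 * t)) / ln t)"

lemma scales_pos:
  assumes "1 < t"
  shows "0 < height_scale q t" "0 < space_scale q t"
  using assms by (auto simp: height_scale_def space_scale_def)

lemma penalty_eq_scaled_penalty:
  fixes z :: "int^'n"
  assumes "1 < t"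
  shows "penalty t z
    = height_scale q t * scaled_penalty CARD('n) q t (l1_norm (of_int_vec z) / space_scale q t)"
proof -
  have "space_scale q t = height_scale q t * (t / ln t)"
    using assms by (simp add: space_scale_def height_scale_def powr_add)
  then show ?thesis
    using scales_pos[OF assms, of q] assms
    by (simp add: penalty_def scaled_penalty_def field_simps)
qed

text \<open>The defining relation between the two scales: a box of side \<open>space_scale q t\<close> contains about as many sites
  as are needed for a Pareto variable of height \<open>height_scale q t\<close> to occur among them. It is
  what singles out the value of \<open>q\<close>.\<close>

lemma height_scale_powr:
  assumes "real d < \<alpha>" "1 < t"
  shows "height_scale (q_const d \<alpha>) t powr (- \<alpha>) = 1 / space_scale (q_const d \<alpha>) t ^ d"
proof -
  have "q_const d \<alpha> * \<alpha> = (q_const d \<alpha> + 1) * d"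
    using assms by (simp add: q_const_def field_simps)
  then show ?thesis
    using assms by (simp add: height_scale_def space_scale_def powr_powr powr_minus_divide
        flip: powr_realpow)
qed

lemma filterlim_height_scale: "0 < q \<Longrightarrow> filterlim (height_scale q) at_top at_top"
  unfolding height_scale_def by real_asymp

lemma filterlim_space_scale: "0 < q \<Longrightarrow> filterlim (space_scale q) at_top at_top"
  unfolding space_scale_def by real_asymp

text \<open>This is where the slope \<open>q\<close> of the limiting penalty comes from: \<open>space_scale q t / t\<close> is \<open>t powr q\<close> up to
  powers of \<open>ln t\<close>.\<close>

lemma scaled_penalty_rate_tendsto:
  assumes "0 < q" "0 < d"
  shows "((\<lambda>t. ln (space_scale q t / (2 * real d * exp 1 * t)) / ln t) \<longlongrightarrow> q) at_top"
proof -
  let ?C = "ln (2 * real d * exp 1)"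
  have 1: "((\<lambda>t::real. ln (ln t) / ln t) \<longlongrightarrow> 0) at_top" by real_asymp
  have 2: "((\<lambda>t::real. 1 / ln t) \<longlongrightarrow> 0) at_top" by real_asymp
  have "((\<lambda>t. q - (q + 1) * (ln (ln t) / ln t) - ?C * (1 / ln t)) \<longlongrightarrow> q - (q + 1) * 0 - ?C * 0) at_top"
    by (intro tendsto_intros 1 2)
  moreover have "\<forall>\<^sub>F t in at_top. q - (q + 1) * (ln (ln t) / ln t) - ?C * (1 / ln t)
      = ln (space_scale q t / (2 * real d * exp 1 * t)) / ln t"
    using eventually_gt_at_top[of 1]
  proof eventually_elim
    case (elim t)
    then have "0 < t" "0 < ln t" by auto
    then have eq: "ln (space_scale q t / (2 * real d * exp 1 * t))
        = (q + 1) * (ln t - ln (ln t)) - ?C - ln t"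
      using assms(2) by (simp add: space_scale_def ln_div ln_mult ln_powr)
    have "q - (q + 1) * (b / L) - C * (1 / L) = ((q + 1) * (L - b) - C - L) / L" if "0 < L" for b C L :: real
      using that by (simp add: field_simps)
    with \<open>0 < ln t\<close> show ?case unfolding eq by blast
  qed
  ultimately show ?thesis
    by (subst (asm) tendsto_cong) auto
qed

lemma scaled_penalty_eq:
  assumes "1 < t" "0 < s" "0 < d"
  shows "scaled_penalty d q t s
    = s * (ln s / ln t + ln (space_scale q t / (2 * real d * exp 1 * t)) / ln t)"
  using scales_pos[OF assms(1), of q] assms
  by (simp add: scaled_penalty_def ln_mult ln_div add_divide_distrib diff_divide_distrib)

lemma scaled_penalty_tendsto:
  assumes "0 < q" "0 < d" "filterlim X at_top F" "(\<sigma> \<longlongrightarrow> s) F" "0 < s"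
  shows "((\<lambda>n. scaled_penalty d q (X n) (\<sigma> n)) \<longlongrightarrow> q * s) F"
proof -
  have "((\<lambda>n. ln (\<sigma> n)) \<longlongrightarrow> ln s) F"
    using assms by (intro tendsto_ln) auto
  moreover have "filterlim (\<lambda>n. ln (X n)) at_infinity F"
    using filterlim_compose[OF ln_at_top assms(3)] by (rule filterlim_at_top_imp_at_infinity)
  ultimately have "((\<lambda>n. ln (\<sigma> n) / ln (X n)) \<longlongrightarrow> 0) F"
    by (rule tendsto_divide_0)
  then have "((\<lambda>n. \<sigma> n * (ln (\<sigma> n) / ln (X n)
      + ln (space_scale q (X n) / (2 * real d * exp 1 * X n)) / ln (X n))) \<longlongrightarrow> s * (0 + q)) F"
    using filterlim_compose[OF scaled_penalty_rate_tendsto[OF assms(1,2)] assms(3)] assms(4)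
    by (intro tendsto_intros)
  moreover have "\<forall>\<^sub>F n in F. \<sigma> n * (ln (\<sigma> n) / ln (X n)
      + ln (space_scale q (X n) / (2 * real d * exp 1 * X n)) / ln (X n)) = scaled_penalty d q (X n) (\<sigma> n)"
    using order_tendstoD(1)[OF assms(4,5)] filterlim_at_top_dense[THEN iffD1, OF assms(3), rule_format, of 1]
    by eventually_elim (use assms(2) in \<open>simp add: scaled_penalty_eq\<close>)
  ultimately show ?thesis
    by (subst (asm) tendsto_cong) (auto simp: mult.commute)
qed

text \<open>The function \<open>s * ln (s / (e * m))\<close> is minimal at \<open>s = m\<close>. At distances below \<open>2 * d * e * t\<close> the penalty is negative,
  and this bound shows that the reward is at most the constant \<open>2 * d\<close>.\<close>

lemma mult_ln_lower_bound:
  fixes m s :: real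
  assumes "0 < m" "0 \<le> s"
  shows "- m \<le> s * ln (s / (exp 1 * m))"
proof (cases "s = 0")
  case False
  with assms have s: "0 < s" by simp
  have "ln (m / s) \<le> m / s - 1" using assms s by (intro ln_le_minus_one) auto
  then have "ln (exp 1 * m / s) \<le> m / s" using assms s by (simp add: ln_mult ln_div)
  then have "s * ln (exp 1 * m / s) \<le> m" using s by (simp add: field_simps)
  moreover have "ln (s / (exp 1 * m)) = - ln (exp 1 * m / s)"
    using assms s by (simp add: ln_mult ln_div)
  ultimately show ?thesis by simp
qed (use assms in auto)

lemma penalty_ge:
  fixes z :: "int^'n"
  assumes "0 < t"
  shows "- (2 * real CARD('n)) \<le> penalty t z"
  using mult_ln_lower_bound[of "2 * real CARD('n)" "l1_norm (of_int_vec z) / t"] assms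
  by (simp add: penalty_def mult_ac)

text \<open>A linear lower bound that is uniform in the distance, as needed for domination. Beyond distance one the logarithm of
  \<open>s\<close> helps, and the slope is eventually larger than any given \<open>\<kappa> < q\<close>. Within distance one the penalty may be
  negative, but only by a constant divided by the height scale, which the offset
  \<open>- 2 * \<kappa>\<close> absorbs.\<close>

lemma scaled_penalty_lower_bound:
  assumes "0 < d" "0 < \<kappa>" "\<kappa> < q"
  shows "\<forall>\<^sub>F t in at_top. \<forall>s\<ge>0. \<kappa> * (s - 2) \<le> scaled_penalty d q t s"
proof -
  have q: "0 < q" using assms by linarith
  have "\<forall>\<^sub>F t in at_top. \<kappa> < ln (space_scale q t / (2 * real d * exp 1 * t)) / ln t"
    using order_tendstoD(1)[OF scaled_penalty_rate_tendsto[OF q assms(1)] assms(3)] .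
  moreover have "\<forall>\<^sub>F t in at_top. 2 * real d / \<kappa> \<le> height_scale q t"
    using filterlim_height_scale[OF q] by (simp add: filterlim_at_top)
  moreover have "\<forall>\<^sub>F t::real in at_top. 1 < t" by (rule eventually_gt_at_top)
  ultimately show ?thesis
  proof eventually_elim
    case (elim t)
    show ?case
    proof (intro allI impI)
      fix s :: real assume s: "0 \<le> s"
      show "\<kappa> * (s - 2) \<le> scaled_penalty d q t s"
      proof (cases "1 \<le> s")
        case True
        then have "\<kappa> \<le> ln s / ln t + ln (space_scale q t / (2 * real d * exp 1 * t)) / ln t"
          using elim by (smt (verit) divide_nonneg_pos ln_ge_zero ln_gt_zero)
        then have "s * \<kappa> \<le> scaled_penalty d q t s"
          using True elim assms by (subst scaled_penalty_eq) (auto intro!: mult_left_mono)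
        then show ?thesis using assms(2) by (simp add: algebra_simps)
      next
        case False
        note pos = scales_pos[OF elim(3), of q]
        have sp: "space_scale q t = height_scale q t * (t / ln t)"
          using elim by (simp add: space_scale_def height_scale_def powr_add)
        have "- (2 * real d) \<le> s * space_scale q t / t * ln (s * space_scale q t / t / (exp 1 * (2 * real d)))"
          using pos s elim assms by (intro mult_ln_lower_bound) auto
        also have "\<dots> = height_scale q t * scaled_penalty d q t s"
          using elim pos by (simp add: scaled_penalty_def sp mult_ac)
        finally have 1: "- (2 * real d) \<le> height_scale q t * scaled_penalty d q t s" .
        have 2: "2 * real d \<le> height_scale q t * \<kappa>"
          using elim(2) assms(2) by (simp add: field_simps)
        from 1 2 have "height_scale q t * (- \<kappa>) \<le> height_scale q t * scaled_penalty d q t s"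
          by simp
        then have "- \<kappa> \<le> scaled_penalty d q t s"
          using pos by (simp only: mult_le_cancel_left_pos)
        moreover have "\<kappa> * (s - 2) \<le> \<kappa> * (- 1)"
          using False assms by (intro mult_left_mono) auto
        ultimately show ?thesis by simp
      qed
    qed
  qed
qed

section \<open>Lattice points approximating a point of space\<close>

definition lattice_point :: "real \<Rightarrow> real ^ 'n \<Rightarrow> real ^ 'n" where
  "lattice_point r x = (1 / r) *\<^sub>R of_int_vec (lattice_floor r x)"

lemma l1_norm_lattice_point:
  "0 < r \<Longrightarrow> l1_norm (of_int_vec (lattice_floor r x)) / r = l1_norm (lattice_point r x)"
  by (simp add: lattice_point_def l1_norm_scaleR)

lemma lattice_point_component:
  assumes "0 < r"
  shows "\<bar>lattice_point r x $ i - x $ i\<bar> \<le> 1 / r"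
proof -
  have "\<bar>real_of_int \<lfloor>r * x $ i\<rfloor> - r * x $ i\<bar> \<le> 1" by linarith
  moreover have "real_of_int \<lfloor>r * x $ i\<rfloor> - r * x $ i = r * (lattice_point r x $ i - x $ i)"
    using assms by (simp add: lattice_point_def of_int_vec_def lattice_floor_def field_simps)
  ultimately have "\<bar>r * (lattice_point r x $ i - x $ i)\<bar> \<le> 1" by simp
  then have "r * \<bar>lattice_point r x $ i - x $ i\<bar> \<le> 1"
    using assms by (simp only: abs_mult abs_of_pos)
  then show ?thesis
    using assms by (simp add: pos_le_divide_eq mult.commute)
qed

lemma lattice_point_tendsto:
  assumes "filterlim R at_top F"
  shows "((\<lambda>n. lattice_point (R n) x) \<longlongrightarrow> x) F"
proof (rule vec_tendstoI)
  fix i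
  have "((\<lambda>n. lattice_point (R n) x $ i - x $ i) \<longlongrightarrow> 0) F"
  proof (rule tendsto_0_le[where K = 1])
    show "((\<lambda>n. 1 / R n) \<longlongrightarrow> 0) F"
      using tendsto_divide_0[OF tendsto_const filterlim_at_top_imp_at_infinity[OF assms]] .
    show "\<forall>\<^sub>F n in F. norm (lattice_point (R n) x $ i - x $ i) \<le> norm (1 / R n) * 1"
      using filterlim_at_top_dense[THEN iffD1, OF assms, rule_format, of 0]
      by eventually_elim (use lattice_point_component in auto)
  qed
  then show "((\<lambda>n. lattice_point (R n) x $ i) \<longlongrightarrow> x $ i) F"
    by (rule LIM_zero_cancel)
qed

lemma l1_norm_lattice_point_ge:
  fixes x :: "real^'n"
  assumes "0 < r"
  shows "l1_norm x - CARD('n) / r \<le> l1_norm (lattice_point r x)"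
proof -
  have "l1_norm x \<le> l1_norm (lattice_point r x) + l1_norm (x - lattice_point r x)"
    using l1_norm_triangle[of "lattice_point r x" "x - lattice_point r x"] by simp
  also have "l1_norm (x - lattice_point r x) \<le> (\<Sum>i\<in>(UNIV::'n set). 1 / r)"
    unfolding l1_norm_def using lattice_point_component[OF assms, of x]
    by (intro sum_mono) (simp add: abs_minus_commute)
  finally show ?thesis by simp
qed

lemma scaled_penalty_lattice_tendsto:
  fixes x :: "real^'n"
  assumes "0 < q" "filterlim X at_top F"
  shows "((\<lambda>n. scaled_penalty CARD('n) q (X n) (l1_norm (lattice_point (space_scale q (X n)) x)))
    \<longlongrightarrow> q * l1_norm x) F"
proof (cases "x = 0")
  case True
  then have "l1_norm (lattice_point r x) = 0" for r
    by (simp add: lattice_point_def l1_norm_def of_int_vec_def lattice_floor_def)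
  with True show ?thesis by (simp add: scaled_penalty_def l1_norm_eq_0_iff[THEN iffD2])
next
  case False
  then have "0 < l1_norm x" using l1_norm_nonneg[of x] l1_norm_eq_0_iff[of x] by linarith
  moreover have "((\<lambda>n. l1_norm (lattice_point (space_scale q (X n)) x)) \<longlongrightarrow> l1_norm x) F"
    using continuous_on_tendsto_compose[OF continuous_on_l1_norm[OF continuous_on_id, of UNIV]
      lattice_point_tendsto[OF filterlim_compose[OF filterlim_space_scale[OF assms(1)] assms(2)]]]
    by simp
  ultimately show ?thesis
    using assms by (intro scaled_penalty_tendsto) auto
qed

section \<open>Expected number of sites above a level\<close>

text \<open>The sum of the tails \<open>P (Psi t \<xi> z > a * y)\<close> over all sites is, after division of all heights by \<open>a\<close>, the integral of
  a step function on the lattice cells. The integrands converge pointwise because the scaled penalty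
  tends to \<open>q * l1_norm x\<close>, and the linear lower bound on the penalty
  dominates them by an integrable power of \<open>l1_norm x\<close>.\<close>

lemma level_intensity_tendsto:
  fixes \<alpha> y :: real and X :: "nat \<Rightarrow> real"
  defines "q \<equiv> q_const CARD('n) \<alpha>"
  assumes \<alpha>: "real CARD('n) < \<alpha>" and y: "0 < y" and X: "filterlim X at_top sequentially"
  shows "(\<lambda>n. \<integral>\<^sup>+z. ennreal ((height_scale q (X n) * y + penalty (X n) (z :: int^'n)) powr (- \<alpha>))
      \<partial>count_space UNIV) \<longlonglongrightarrow> ennreal (mu_const CARD('n) \<alpha> * y powr (CARD('n) - \<alpha>))"
proof -
  have q: "0 < q" using \<alpha> by (simp add: q_def q_const_pos)
  \<comment> \<open>The slope of the dominating function: below \<open>q\<close>, and small enough that the offset \<open>- 2 * \<kappa>\<close> of the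
     linear bound and the discretisation error each cost at most a quarter of \<open>y\<close>.\<close>
  define \<kappa> where "\<kappa> = min (q / 2) (y / 8)"
  have \<kappa>: "0 < \<kappa>" "\<kappa> < q" "2 * \<kappa> \<le> y / 4" using q y by (auto simp: \<kappa>_def min_def)
  define c where "c n x = scaled_penalty CARD('n) q (X n) (l1_norm (lattice_point (space_scale q (X n)) (x :: real^'n)))"
    for n x
  have [measurable]: "c n \<in> borel_measurable borel" for n
    unfolding c_def scaled_penalty_def lattice_point_def by measurable
  have "\<forall>\<^sub>F n in sequentially. 1 < X n"
    using X by (simp add: filterlim_at_top_dense)
  moreover have "\<forall>\<^sub>F n in sequentially. \<forall>s\<ge>0. \<kappa> * (s - 2) \<le> scaled_penalty CARD('n) q (X n) s"
    using scaled_penalty_lower_bound[OF zero_less_card_finite \<kappa>(1,2)] X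
    by (rule eventually_compose_filterlim)
  moreover have "\<forall>\<^sub>F n in sequentially. 4 * \<kappa> * CARD('n) / y \<le> space_scale q (X n)"
    using filterlim_compose[OF filterlim_space_scale[OF q] X] by (simp add: filterlim_at_top)
  ultimately have "\<forall>\<^sub>F n in sequentially. 1 < X n
      \<and> (\<forall>s\<ge>0. \<kappa> * (s - 2) \<le> scaled_penalty CARD('n) q (X n) s)
      \<and> 4 * \<kappa> * CARD('n) / y \<le> space_scale q (X n)"
    by eventually_elim auto
  then obtain N where N: "\<And>n. N \<le> n \<Longrightarrow> 1 < X n"
      "\<And>n s. N \<le> n \<Longrightarrow> 0 \<le> s \<Longrightarrow> \<kappa> * (s - 2) \<le> scaled_penalty CARD('n) q (X n) s"
      "\<And>n. N \<le> n \<Longrightarrow> 4 * \<kappa> * CARD('n) / y \<le> space_scale q (X n)"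
    by (auto simp: eventually_sequentially)
  have bound: "y / 2 + \<kappa> * l1_norm x \<le> y + c n x" if "N \<le> n" for n x
  proof -
    note r = scales_pos(2)[OF N(1)[OF that], of q]
    have "\<kappa> * (CARD('n) / space_scale q (X n)) \<le> y / 4"
      using N(3)[OF that] r y \<kappa> by (simp add: field_simps)
    moreover have "\<kappa> * (l1_norm x - CARD('n) / space_scale q (X n)) \<le> \<kappa> * l1_norm (lattice_point (space_scale q (X n)) x)"
      using l1_norm_lattice_point_ge[OF r] \<kappa>(1) by simp
    moreover have "\<kappa> * (l1_norm (lattice_point (space_scale q (X n)) x) - 2) \<le> c n x"
      unfolding c_def by (rule N(2)[OF that]) simp
    ultimately show ?thesis using \<kappa>(3) unfolding right_diff_distrib by linarith
  qed
  have cells: "(\<integral>\<^sup>+z. ennreal ((height_scale q (X n) * y + penalty (X n) (z :: int^'n)) powr (- \<alpha>)) \<partial>count_space UNIV)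
      = (\<integral>\<^sup>+x. ennreal ((y + c n x) powr (- \<alpha>)) \<partial>lborel)" if "N \<le> n" for n
  proof -
    note pos = scales_pos[OF N(1)[OF that], of q]
    let ?s = "\<lambda>z :: int^'n. scaled_penalty CARD('n) q (X n) (l1_norm (of_int_vec z) / space_scale q (X n))"
    have nonneg: "0 \<le> y + ?s z" for z
    proof -
      have "\<kappa> * (l1_norm (of_int_vec z) / space_scale q (X n) - 2) \<le> ?s z"
        using pos by (intro N(2)[OF that]) auto
      moreover have "0 \<le> \<kappa> * (l1_norm (of_int_vec z) / space_scale q (X n))"
        using pos \<kappa> by auto
      ultimately show ?thesis using \<kappa>(3) y by (simp add: algebra_simps)
    qed
    have eq: "(height_scale q (X n) * y + penalty (X n) z) powr (- \<alpha>)
        = 1 / space_scale q (X n) ^ CARD('n) * (y + ?s z) powr (- \<alpha>)" for z :: "int^'n"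
    proof -
      have "height_scale q (X n) * y + penalty (X n) z = height_scale q (X n) * (y + ?s z)"
        by (simp add: penalty_eq_scaled_penalty[OF N(1)[OF that], of z q] distrib_left)
      then show ?thesis
        using pos nonneg by (simp only: powr_mult height_scale_powr[OF \<alpha> N(1)[OF that], folded q_def])
    qed
    have "(\<integral>\<^sup>+z. ennreal ((height_scale q (X n) * y + penalty (X n) (z :: int^'n)) powr (- \<alpha>)) \<partial>count_space UNIV)
        = ennreal (1 / space_scale q (X n) ^ CARD('n)) * (\<integral>\<^sup>+z. ennreal ((y + ?s z) powr (- \<alpha>)) \<partial>count_space UNIV)"
      using pos by (subst nn_integral_cmult[symmetric]) (simp_all add: eq flip: ennreal_mult)
    also have "\<dots> = (\<integral>\<^sup>+x. ennreal ((y + ?s (lattice_floor (space_scale q (X n)) x)) powr (- \<alpha>)) \<partial>lborel)"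
      by (rule nn_integral_lattice_floor[OF pos(2), symmetric])
    also have "\<dots> = (\<integral>\<^sup>+x. ennreal ((y + c n x) powr (- \<alpha>)) \<partial>lborel)"
      by (simp add: c_def l1_norm_lattice_point[OF pos(2)])
    finally show ?thesis .
  qed
  have "(\<lambda>n. \<integral>\<^sup>+x. ennreal ((y + c (n + N) x) powr (- \<alpha>)) \<partial>lborel)
      \<longlonglongrightarrow> (\<integral>\<^sup>+x. ennreal ((y + q * l1_norm (x :: real^'n)) powr (- \<alpha>)) \<partial>lborel)"
  proof (rule nn_integral_dominated_convergence[where w = "\<lambda>x. ennreal ((y / 2 + \<kappa> * l1_norm x) powr (- \<alpha>))"])
    show "AE x in lborel. ennreal ((y + c (n + N) x) powr (- \<alpha>)) \<le> ennreal ((y / 2 + \<kappa> * l1_norm x) powr (- \<alpha>))" for n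
      using bound[of "n + N"] y \<kappa> \<alpha>
      by (intro AE_I2 ennreal_leI powr_mono2') (auto intro: add_pos_nonneg)
    show "(\<integral>\<^sup>+x. ennreal ((y / 2 + \<kappa> * l1_norm (x :: real^'n)) powr (- \<alpha>)) \<partial>lborel) < \<infinity>"
      using y \<kappa> \<alpha> by (subst nn_integral_l1_norm_powr) auto
    have "(\<lambda>n. c (n + N) x) \<longlonglongrightarrow> q * l1_norm x" for x
      unfolding c_def by (intro LIMSEQ_ignore_initial_segment scaled_penalty_lattice_tendsto q X)
    moreover have "0 < y + q * l1_norm x" for x :: "real^'n"
      using y q by (intro add_pos_nonneg) auto
    ultimately show "AE x in lborel. (\<lambda>n. ennreal ((y + c (n + N) x) powr (- \<alpha>)))
        \<longlonglongrightarrow> ennreal ((y + q * l1_norm x) powr (- \<alpha>))"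
      by (intro AE_I2 tendsto_intros) (auto simp: less_imp_neq[symmetric])
  qed measurable
  also have "(\<integral>\<^sup>+x. ennreal ((y + q * l1_norm (x :: real^'n)) powr (- \<alpha>)) \<partial>lborel)
      = ennreal (mu_const CARD('n) \<alpha> * y powr (CARD('n) - \<alpha>))"
    using y q \<alpha> by (subst nn_integral_l1_norm_powr) (auto simp: q_def mu_const_eq_Gamma)
  finally have "(\<lambda>n. \<integral>\<^sup>+z. ennreal ((height_scale q (X (n + N)) * y + penalty (X (n + N)) (z :: int^'n)) powr (- \<alpha>))
      \<partial>count_space UNIV) \<longlonglongrightarrow> ennreal (mu_const CARD('n) \<alpha> * y powr (CARD('n) - \<alpha>))"
    by (simp only: cells le_add2)
  then show ?thesis by (rule LIMSEQ_offset[where k = N])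
qed

section \<open>Elementary inequalities\<close>

text \<open>The constant \<open>1 / (1 - \<epsilon>)\<close> tends to one when all tails tend to zero uniformly, so the bound is sharp
  enough for a Poisson limit.\<close>

lemma exp_le_one_minus:
  fixes p \<epsilon> :: real
  assumes "0 \<le> p" "p \<le> \<epsilon>" "\<epsilon> < 1"
  shows "exp (- (p / (1 - \<epsilon>))) \<le> 1 - p"
proof -
  have "1 / (1 - p) = 1 + p / (1 - p)" using assms by (simp add: field_simps)
  also have "\<dots> \<le> exp (p / (1 - p))" by (rule exp_ge_add_one_self)
  also have "\<dots> \<le> exp (p / (1 - \<epsilon>))" using assms by (auto intro!: divide_left_mono)
  finally show ?thesis using assms by (simp add: exp_minus field_simps)
qed

text \<open>The probability that a Pareto variable lies in an interval, bounded by its length times the least value of the density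
  on it.\<close>

lemma powr_diff_ge:
  fixes p \<delta> \<alpha> :: real
  assumes "0 < p" "0 < \<delta>" "0 < \<alpha>"
  shows "\<delta> * (\<alpha> * (p + \<delta>) powr (- (\<alpha> + 1))) \<le> p powr (- \<alpha>) - (p + \<delta>) powr (- \<alpha>)"
proof -
  have "\<exists>z>p. z < p + \<delta> \<and> (p + \<delta>) powr (- \<alpha>) - p powr (- \<alpha>) = (p + \<delta> - p) * (- \<alpha> * z powr (- \<alpha> - 1))"
    using assms by (intro MVT2) (auto intro!: derivative_eq_intros simp: field_simps)
  then obtain z where z: "p < z" "z < p + \<delta>"
    "(p + \<delta>) powr (- \<alpha>) - p powr (- \<alpha>) = (p + \<delta> - p) * (- \<alpha> * z powr (- \<alpha> - 1))" by blast
  have "(p + \<delta>) powr (- (\<alpha> + 1)) \<le> z powr (- (\<alpha> + 1))"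
    using z assms by (intro powr_mono2') auto
  then have "\<delta> * (\<alpha> * (p + \<delta>) powr (- (\<alpha> + 1))) \<le> \<delta> * (\<alpha> * z powr (- (\<alpha> + 1)))"
    using assms by (intro mult_left_mono) auto
  also have "\<dots> = \<delta> * (\<alpha> * z powr (- \<alpha> - 1))" by (simp only: minus_add_distrib diff_conv_add_uminus)
  also have "\<dots> = p powr (- \<alpha>) - (p + \<delta>) powr (- \<alpha>)"
    using z(3) by (simp add: algebra_simps)
  finally show ?thesis .
qed

section \<open>One high site among low ones\<close>

text \<open>Only values \<open>x \<ge> 1\<close> of the distribution function are given; they determine the law, since its value at one
  is zero.\<close>

locale pareto_field = prob_space M
  for M :: "'w measure" and \<xi> :: "int ^ 'n \<Rightarrow> 'w \<Rightarrow> real" and \<alpha> :: real +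
  assumes exponent_gt: "real CARD('n) < \<alpha>"
    and indep: "indep_vars (\<lambda>_. borel) \<xi> UNIV"
    and cdf: "1 \<le> x \<Longrightarrow> prob {\<omega> \<in> space M. \<xi> z \<omega> \<le> x} = 1 - x powr (- \<alpha>)"
begin

lemma measurable_field [measurable]: "\<xi> z \<in> borel_measurable M"
  using indep by (simp add: indep_vars_def)

lemma exponent_pos: "0 < \<alpha>"
  using exponent_gt by linarith

lemma prob_between:
  assumes "1 \<le> u" "u \<le> v"
  shows "prob {\<omega> \<in> space M. u < \<xi> z \<omega> \<and> \<xi> z \<omega> \<le> v} = u powr (- \<alpha>) - v powr (- \<alpha>)"
proof -
  have split: "{\<omega> \<in> space M. u < \<xi> z \<omega> \<and> \<xi> z \<omega> \<le> v}
      = {\<omega> \<in> space M. \<xi> z \<omega> \<le> v} - {\<omega> \<in> space M. \<xi> z \<omega> \<le> u}" by auto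
  show ?thesis
    unfolding split using assms by (subst finite_measure_Diff) (auto simp: cdf)
qed

lemma prob_isolated_finite:
  assumes "1 \<le> u" "u \<le> v" and b: "\<And>w. 1 \<le> b w" and "finite J"
  shows "prob {\<omega> \<in> space M. u < \<xi> z \<omega> \<and> \<xi> z \<omega> \<le> v \<and> (\<forall>w\<in>J. w \<noteq> z \<longrightarrow> \<xi> w \<omega> \<le> b w)}
    = (u powr (- \<alpha>) - v powr (- \<alpha>)) * (\<Prod>w\<in>J - {z}. 1 - b w powr (- \<alpha>))"
proof -
  \<comment> \<open>The site \<open>z\<close> has its own constraint, so it is removed from \<open>J\<close> if it occurs there.\<close>
  define B where "B w = (if w = z then {u<..v} else {..b w})" for w
  have "prob (\<Inter>w\<in>insert z J. \<xi> w -` B w \<inter> space M) = (\<Prod>w\<in>insert z J. prob (\<xi> w -` B w \<inter> space M))"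
    using \<open>finite J\<close> by (intro indep_varsD[OF indep]) (auto simp: B_def)
  also have "insert z J = insert z (J - {z})" by auto
  also have "(\<Prod>w\<in>\<dots>. prob (\<xi> w -` B w \<inter> space M))
      = prob (\<xi> z -` B z \<inter> space M) * (\<Prod>w\<in>J - {z}. prob (\<xi> w -` B w \<inter> space M))"
    using \<open>finite J\<close> by (subst prod.insert) auto
  also have "\<xi> z -` B z \<inter> space M = {\<omega> \<in> space M. u < \<xi> z \<omega> \<and> \<xi> z \<omega> \<le> v}"
    by (auto simp: B_def)
  also have "prob \<dots> = u powr (- \<alpha>) - v powr (- \<alpha>)" by (rule prob_between) fact+
  also have "(\<Prod>w\<in>J - {z}. prob (\<xi> w -` B w \<inter> space M)) = (\<Prod>w\<in>J - {z}. 1 - b w powr (- \<alpha>))"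
  proof (rule prod.cong[OF refl])
    fix w assume "w \<in> J - {z}"
    then have "\<xi> w -` B w \<inter> space M = {\<omega> \<in> space M. \<xi> w \<omega> \<le> b w}" by (auto simp: B_def)
    then show "prob (\<xi> w -` B w \<inter> space M) = 1 - b w powr (- \<alpha>)" using cdf[OF b] by simp
  qed
  also have "(\<Inter>w\<in>insert z (J - {z}). \<xi> w -` B w \<inter> space M)
      = {\<omega> \<in> space M. u < \<xi> z \<omega> \<and> \<xi> z \<omega> \<le> v \<and> (\<forall>w\<in>J. w \<noteq> z \<longrightarrow> \<xi> w \<omega> \<le> b w)}"
    by (auto simp: B_def)
  finally show ?thesis .
qed

text \<open>One site lies in a window and all others stay below their thresholds. For finitely many
  other sites the probability is a product, which is bounded below uniformly in their
  number through the total \<open>S\<close> of the tails; continuity from above then passes to the whole lattice.\<close>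

lemma prob_isolated_ge:
  assumes uv: "1 \<le> u" "u \<le> v" and b: "\<And>w. 1 \<le> b w"
    and \<epsilon>: "\<And>w. b w powr (- \<alpha>) \<le> \<epsilon>" "\<epsilon> < 1"
    and S: "(\<integral>\<^sup>+w. ennreal (b w powr (- \<alpha>)) \<partial>count_space UNIV) \<le> ennreal S" "0 \<le> S"
  shows "(u powr (- \<alpha>) - v powr (- \<alpha>)) * exp (- (S / (1 - \<epsilon>)))
    \<le> prob {\<omega> \<in> space M. u < \<xi> z \<omega> \<and> \<xi> z \<omega> \<le> v \<and> (\<forall>w. w \<noteq> z \<longrightarrow> \<xi> w \<omega> \<le> b w)}"
proof -
  define A where "A J = {\<omega> \<in> space M. u < \<xi> z \<omega> \<and> \<xi> z \<omega> \<le> v \<and> (\<forall>w\<in>J. w \<noteq> z \<longrightarrow> \<xi> w \<omega> \<le> b w)}" for J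
  define J where "J n = {w :: int^'n. to_nat w < n}" for n
  have fin: "finite (J n)" for n
    using finite_vimageI[OF finite_lessThan[of n] inj_to_nat, where 'a1 = "int^'n"]
    by (simp add: J_def vimage_def)
  have A: "(u powr (- \<alpha>) - v powr (- \<alpha>)) * exp (- (S / (1 - \<epsilon>))) \<le> prob (A K)" if "finite K" for K
  proof -
    have "ennreal (\<Sum>w\<in>K - {z}. b w powr (- \<alpha>)) = (\<integral>\<^sup>+w. ennreal (b w powr (- \<alpha>)) * indicator (K - {z}) w \<partial>count_space UNIV)"
      using that by (simp add: sum_ennreal nn_integral_count_space_finite flip: nn_integral_count_space_indicator)
    also have "\<dots> \<le> (\<integral>\<^sup>+w. ennreal (b w powr (- \<alpha>)) \<partial>count_space UNIV)"
      by (intro nn_integral_mono) (auto simp: indicator_def)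
    also note S(1)
    finally have sum: "(\<Sum>w\<in>K - {z}. b w powr (- \<alpha>)) \<le> S"
      using S(2) by (subst (asm) ennreal_le_iff) auto
    then have "(\<Sum>w\<in>K - {z}. b w powr (- \<alpha>)) / (1 - \<epsilon>) \<le> S / (1 - \<epsilon>)"
      using \<epsilon>(2) by (intro divide_right_mono) auto
    then have "exp (- (S / (1 - \<epsilon>))) \<le> exp (- (\<Sum>w\<in>K - {z}. b w powr (- \<alpha>)) / (1 - \<epsilon>))"
      by simp
    also have "\<dots> = (\<Prod>w\<in>K - {z}. exp (- (b w powr (- \<alpha>) / (1 - \<epsilon>))))"
      using that by (simp add: sum_divide_distrib flip: exp_sum sum_negf)
    also have "\<dots> \<le> (\<Prod>w\<in>K - {z}. 1 - b w powr (- \<alpha>))"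
      using \<epsilon> by (intro prod_mono) (auto intro!: exp_le_one_minus)
    finally show ?thesis
      unfolding A_def prob_isolated_finite[OF uv b that]
      using uv exponent_pos by (intro mult_left_mono) (auto intro!: powr_mono2')
  qed
  have "(\<lambda>n. prob (A (J n))) \<longlonglongrightarrow> prob (\<Inter>n. A (J n))"
  proof (rule finite_Lim_measure_decseq)
    have "A (J n) \<in> sets M" for n unfolding A_def by measurable
    then show "range (\<lambda>n. A (J n)) \<subseteq> sets M" by auto
    show "decseq (\<lambda>n. A (J n))" by (auto simp: decseq_def A_def J_def)
  qed
  then have "(u powr (- \<alpha>) - v powr (- \<alpha>)) * exp (- (S / (1 - \<epsilon>))) \<le> prob (\<Inter>n. A (J n))"
    by (rule LIMSEQ_le_const) (use A[OF fin] in auto)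
  also have "(\<Inter>n. A (J n)) = {\<omega> \<in> space M. u < \<xi> z \<omega> \<and> \<xi> z \<omega> \<le> v \<and> (\<forall>w. w \<noteq> z \<longrightarrow> \<xi> w \<omega> \<le> b w)}"
    unfolding A_def J_def by (auto intro: lessI)
  finally show ?thesis .
qed

text \<open>With \<open>a\<close> as the unit of height: at the rescaled level \<open>y\<close> only the site \<open>z\<close> is
  exceeding, and it does so by at most \<open>\<delta>\<close>.\<close>

definition isolated_event :: "real \<Rightarrow> real \<Rightarrow> real \<Rightarrow> int ^ 'n \<Rightarrow> real \<Rightarrow> 'w set" where
  "isolated_event t a \<delta> z y = {\<omega> \<in> space M. a * y + penalty t z < \<xi> z \<omega>
     \<and> \<xi> z \<omega> \<le> a * (y + \<delta>) + penalty t z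
     \<and> (\<forall>w. w \<noteq> z \<longrightarrow> \<xi> w \<omega> \<le> a * y + penalty t w)}"

lemma measurable_prob_isolated_event [measurable]:
  "(\<lambda>y. prob (isolated_event t a \<delta> z y)) \<in> borel_measurable borel"
proof -
  define E where "E y \<omega> \<longleftrightarrow> a * y + penalty t z < \<xi> z \<omega> \<and> \<xi> z \<omega> \<le> a * (y + \<delta>) + penalty t z
        \<and> (\<forall>w. w \<noteq> z \<longrightarrow> \<xi> w \<omega> \<le> a * y + penalty t w)" for y \<omega>
  have "Measurable.pred (borel \<Otimes>\<^sub>M M) (\<lambda>(y, \<omega>). E y \<omega>)"
    unfolding E_def by measurable
  then have "(\<lambda>(y, \<omega>). indicator {p. case p of (y, \<omega>) \<Rightarrow> E y \<omega>} (y, \<omega>) :: ennreal)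
      \<in> borel_measurable (borel \<Otimes>\<^sub>M M)"
    by measurable
  then have "(\<lambda>y. enn2real (\<integral>\<^sup>+\<omega>. indicator {p. case p of (y, \<omega>) \<Rightarrow> E y \<omega>} (y, \<omega>) \<partial>M)) \<in> borel_measurable borel"
    by (intro borel_measurable_enn2real borel_measurable_nn_integral)
  also have "(\<lambda>y. enn2real (\<integral>\<^sup>+\<omega>. indicator {p. case p of (y, \<omega>) \<Rightarrow> E y \<omega>} (y, \<omega>) \<partial>M))
      = (\<lambda>y. prob (isolated_event t a \<delta> z y))"
  proof
    fix y
    have "Measurable.pred M (E y)" unfolding E_def by measurable
    then have "isolated_event t a \<delta> z y \<in> sets M"
      unfolding isolated_event_def E_def by measurable
    moreover have "(\<integral>\<^sup>+\<omega>. indicator {p. case p of (y, \<omega>) \<Rightarrow> E y \<omega>} (y, \<omega>) \<partial>M)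
        = (\<integral>\<^sup>+\<omega>. indicator (isolated_event t a \<delta> z y) \<omega> \<partial>M)"
      by (intro nn_integral_cong) (auto simp: indicator_def isolated_event_def E_def)
    ultimately show "enn2real (\<integral>\<^sup>+\<omega>. indicator {p. case p of (y, \<omega>) \<Rightarrow> E y \<omega>} (y, \<omega>) \<partial>M)
        = prob (isolated_event t a \<delta> z y)"
      by (simp add: emeasure_eq_measure)
  qed
  finally show ?thesis .
qed

text \<open>Fix an outcome. On the isolated event \<open>z\<close> is the strict maximiser, and
  the levels \<open>y\<close> for which the event occurs lie in an interval of length \<open>\<delta>\<close>. So the integral over
  \<open>y\<close> of its indicator divided by \<open>\<delta>\<close> is at most the indicator that \<open>z\<close> is the maximiser. Taking expectations
  and exchanging integrals gives the claim. The averaging replaces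
  conditioning on the value at \<open>z\<close>: it involves only probabilities of windows.\<close>

lemma nn_integral_isolated_le_prob_maximiser:
  assumes [measurable]: "Y \<in> M \<rightarrow>\<^sub>M count_space UNIV"
    and max: "AE \<omega> in M. is_arg_max (Psi t (\<lambda>z. \<xi> z \<omega>)) (\<lambda>_. True) (Y \<omega>)"
    and "0 < a" "0 < \<delta>"
  shows "(\<integral>\<^sup>+y\<in>{0<..}. ennreal (prob (isolated_event t a \<delta> z y) / \<delta>) \<partial>lborel)
    \<le> ennreal (prob {\<omega> \<in> space M. Y \<omega> = z})"
proof -
  interpret pair_sigma_finite M "lborel :: real measure" ..
  define E where "E y \<omega> \<longleftrightarrow> a * y + penalty t z < \<xi> z \<omega> \<and> \<xi> z \<omega> \<le> a * (y + \<delta>) + penalty t z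
        \<and> (\<forall>w. w \<noteq> z \<longrightarrow> \<xi> w \<omega> \<le> a * y + penalty t w)" for y \<omega>
  have meas: "Measurable.pred (M \<Otimes>\<^sub>M lborel) (\<lambda>(\<omega>, y). E y \<omega>)"
    unfolding E_def by measurable
  have meas': "(\<lambda>(\<omega>, y). indicator {p. case p of (\<omega>, y) \<Rightarrow> E y \<omega>} (\<omega>, y) / ennreal \<delta> :: ennreal) \<in> borel_measurable (M \<Otimes>\<^sub>M lborel)"
    using meas by measurable
  have [measurable]: "Measurable.pred M (E y)" for y
    unfolding E_def by measurable
  have "(\<integral>\<^sup>+y\<in>{0<..}. ennreal (prob {\<omega> \<in> space M. E y \<omega>} / \<delta>) \<partial>lborel)
      \<le> (\<integral>\<^sup>+y. ennreal (prob {\<omega> \<in> space M. E y \<omega>} / \<delta>) \<partial>lborel)"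
    by (intro nn_integral_mono) (auto simp: indicator_def)
  also have "\<dots> = (\<integral>\<^sup>+y. (\<integral>\<^sup>+\<omega>. indicator {p. case p of (\<omega>, y) \<Rightarrow> E y \<omega>} (\<omega>, y) / ennreal \<delta> \<partial>M) \<partial>lborel)"
  proof (intro nn_integral_cong)
    fix y
    have "(\<integral>\<^sup>+\<omega>. indicator {p. case p of (\<omega>, y) \<Rightarrow> E y \<omega>} (\<omega>, y) / ennreal \<delta> \<partial>M)
        = (\<integral>\<^sup>+\<omega>. indicator {\<omega> \<in> space M. E y \<omega>} \<omega> / ennreal \<delta> \<partial>M)"
      by (intro nn_integral_cong) (auto simp: indicator_def)
    also have "\<dots> = ennreal (prob {\<omega> \<in> space M. E y \<omega>} / \<delta>)"
      using \<open>0 < \<delta>\<close> by (subst nn_integral_divide) (auto simp: emeasure_eq_measure divide_ennreal)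
    finally show "ennreal (prob {\<omega> \<in> space M. E y \<omega>} / \<delta>)
        = (\<integral>\<^sup>+\<omega>. indicator {p. case p of (\<omega>, y) \<Rightarrow> E y \<omega>} (\<omega>, y) / ennreal \<delta> \<partial>M)" by simp
  qed
  also have "\<dots> = (\<integral>\<^sup>+\<omega>. (\<integral>\<^sup>+y. indicator {p. case p of (\<omega>, y) \<Rightarrow> E y \<omega>} (\<omega>, y) / ennreal \<delta> \<partial>lborel) \<partial>M)"
    using meas' by (rule Fubini')
  also have "\<dots> \<le> (\<integral>\<^sup>+\<omega>. indicator {\<omega> \<in> space M. Y \<omega> = z} \<omega> \<partial>M)"
  proof (rule nn_integral_mono_AE)
    show "AE \<omega> in M. (\<integral>\<^sup>+y. indicator {p. case p of (\<omega>, y) \<Rightarrow> E y \<omega>} (\<omega>, y) / ennreal \<delta> \<partial>lborel)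
        \<le> indicator {\<omega> \<in> space M. Y \<omega> = z} \<omega>"
      using max AE_space
    proof eventually_elim
      case (elim \<omega>)
      let ?p = "(\<xi> z \<omega> - penalty t z) / a"
      have sub: "?p - \<delta> \<le> y \<and> y \<le> ?p" if "E y \<omega>" for y
        using that \<open>0 < a\<close> by (auto simp: E_def field_simps)
      have eq: "Y \<omega> = z" if "E y \<omega>" for y
      proof (rule ccontr)
        assume "Y \<omega> \<noteq> z"
        with that have "Psi t (\<lambda>z. \<xi> z \<omega>) (Y \<omega>) < Psi t (\<lambda>z. \<xi> z \<omega>) z"
          by (auto simp: E_def Psi_eq_diff_penalty algebra_simps dest!: spec[of _ "Y \<omega>"])
        with elim(1) show False by (auto simp: is_arg_max_def)
      qed
      have "(\<integral>\<^sup>+y. indicator {p. case p of (\<omega>, y) \<Rightarrow> E y \<omega>} (\<omega>, y) / ennreal \<delta> \<partial>lborel)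
          \<le> (\<integral>\<^sup>+y. indicator {\<omega> \<in> space M. Y \<omega> = z} \<omega> * (indicator {?p - \<delta>..?p} y / ennreal \<delta>) \<partial>lborel)"
        using sub eq elim(2) by (intro nn_integral_mono) (auto simp: indicator_def)
      also have "\<dots> = indicator {\<omega> \<in> space M. Y \<omega> = z} \<omega>"
        using \<open>0 < \<delta>\<close> by (simp add: nn_integral_cmult nn_integral_divide divide_ennreal)
      finally show ?case .
    qed
  qed
  also have "\<dots> = ennreal (prob {\<omega> \<in> space M. Y \<omega> = z})"
    by (simp add: emeasure_eq_measure)
  finally show ?thesis unfolding E_def isolated_event_def .
qed

end

section \<open>Lower bound for the rescaled local density\<close>

lemma tendsto_le_liminf_ennreal:
  assumes "g \<longlonglongrightarrow> l" "\<forall>\<^sub>F n in sequentially. g n \<le> (F n :: ennreal)"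
  shows "l \<le> liminf F"
  using Liminf_mono[OF assms(2)] lim_imp_Liminf[OF _ assms(1)] by simp

context pareto_field
begin

text \<open>The bound for an isolated site, rescaled: as the tail of the Pareto law is homogeneous, the factor
  \<open>a powr (-\<alpha>)\<close> cancels the number \<open>r ^ d\<close> of sites per unit volume. The weights \<open>s n\<close> later carry
  the values of a test function at the lattice points, so that no product of a limit with a lower limit has
  to be treated separately.\<close>

lemma joint_density_le_liminf:
  fixes X \<delta> s :: "nat \<Rightarrow> real" and x :: "real^'n"
  defines "q \<equiv> q_const CARD('n) \<alpha>"
  assumes X: "filterlim X at_top sequentially" and y: "0 < y"
    and \<delta>: "\<And>n. 0 < \<delta> n" "\<delta> \<longlonglongrightarrow> 0" and s: "\<And>n. 0 \<le> s n" "s \<longlonglongrightarrow> s'"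
  shows "ennreal (s' * joint_density \<alpha> x y) \<le> liminf (\<lambda>n. ennreal (s n * (space_scale q (X n) ^ CARD('n)
    * (prob (isolated_event (X n) (height_scale q (X n)) (\<delta> n) (lattice_floor (space_scale q (X n)) x) y) / \<delta> n))))"
proof -
  note \<alpha> = exponent_gt exponent_pos
  have q: "0 < q" using \<alpha> by (simp add: q_def q_const_pos)
  define a where "a n = height_scale q (X n)" for n
  define R where "R n = space_scale q (X n)" for n
  define c where "c n = scaled_penalty CARD('n) q (X n) (l1_norm (lattice_point (R n) x))" for n
  define S where "S n = (\<integral>\<^sup>+w. ennreal ((a n * y + penalty (X n) (w :: int^'n)) powr (- \<alpha>)) \<partial>count_space UNIV)" for n
  define \<epsilon> where "\<epsilon> n = (a n * (y / 2)) powr (- \<alpha>)" for n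
  define G where "G n = \<alpha> * (exp (- (enn2real (S n) / (1 - \<epsilon> n))) * (y + c n + \<delta> n) powr (- (\<alpha> + 1)))" for n
  have a_lim: "filterlim a at_top sequentially"
    unfolding a_def by (rule filterlim_compose[OF filterlim_height_scale[OF q] X])
  have c_lim: "c \<longlonglongrightarrow> q * l1_norm x"
    unfolding c_def R_def by (rule scaled_penalty_lattice_tendsto[OF q X])
  have S_lim: "S \<longlonglongrightarrow> ennreal (mu_const CARD('n) \<alpha> * y powr (CARD('n) - \<alpha>))"
    unfolding S_def a_def q_def by (rule level_intensity_tendsto[OF \<alpha>(1) y X])
  then have Sr_lim: "(\<lambda>n. enn2real (S n)) \<longlonglongrightarrow> mu_const CARD('n) \<alpha> * y powr (CARD('n) - \<alpha>)"
    using mu_const_pos[OF \<alpha>(1) zero_less_card_finite] by (intro tendsto_enn2real) auto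
  have ay_lim: "filterlim (\<lambda>n. a n * (y / 2)) at_top sequentially"
    using y by (intro filterlim_at_top_mult_tendsto_pos[OF tendsto_const _ a_lim]) auto
  then have \<epsilon>_lim: "\<epsilon> \<longlonglongrightarrow> 0"
    unfolding \<epsilon>_def using \<alpha> by (intro tendsto_neg_powr) auto
  have pos: "0 < y + q * l1_norm x" using y q by (intro add_pos_nonneg) auto
  have "G \<longlonglongrightarrow> \<alpha> * (exp (- ((mu_const CARD('n) \<alpha> * y powr (CARD('n) - \<alpha>)) / (1 - 0)))
      * (y + q * l1_norm x + 0) powr (- (\<alpha> + 1)))"
    unfolding G_def using pos by (intro tendsto_intros Sr_lim c_lim \<epsilon>_lim \<delta>) auto
  then have "G \<longlonglongrightarrow> joint_density \<alpha> x y"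
    by (simp add: joint_density_def q_def)
  then have "(\<lambda>n. ennreal (s n * G n)) \<longlonglongrightarrow> ennreal (s' * joint_density \<alpha> x y)"
    by (intro tendsto_ennrealI tendsto_mult s)
  moreover have "\<forall>\<^sub>F n in sequentially. ennreal (s n * G n) \<le> ennreal (s n * (space_scale q (X n) ^ CARD('n)
    * (prob (isolated_event (X n) (height_scale q (X n)) (\<delta> n) (lattice_floor (space_scale q (X n)) x) y) / \<delta> n)))"
  proof -
    have "\<forall>\<^sub>F n in sequentially. 1 < X n"
      using X by (simp add: filterlim_at_top_dense)
    moreover have "\<forall>\<^sub>F n in sequentially. 1 \<le> a n * (y / 2)"
      using ay_lim unfolding filterlim_at_top by blast
    moreover have "\<forall>\<^sub>F n in sequentially. 2 * real CARD('n) \<le> a n * (y / 2)"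
      using ay_lim unfolding filterlim_at_top by blast
    moreover have "\<forall>\<^sub>F n in sequentially. \<epsilon> n < 1"
      using order_tendstoD(2)[OF \<epsilon>_lim] by simp
    moreover have "\<forall>\<^sub>F n in sequentially. S n < \<top>"
      using order_tendstoD(2)[OF S_lim] by simp
    ultimately show ?thesis
    proof eventually_elim
      case (elim n)
      define z where "z = lattice_floor (R n) x"
      note sc = scales_pos[OF elim(1), of q, folded a_def R_def]
      \<comment> \<open>All thresholds are at least half the level, since the penalty is bounded below; this makes the
         tails uniformly small.\<close>
      have b: "a n * (y / 2) \<le> a n * y + penalty (X n) w" for w :: "int^'n"
      proof -
        have "- (2 * real CARD('n)) \<le> penalty (X n) w"
          using elim(1) by (intro penalty_ge) auto
        with elim(3) show ?thesis by (simp add: algebra_simps)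
      qed
      then have b1: "1 \<le> a n * y + penalty (X n) w" for w :: "int^'n"
        using elim(2) order_trans by blast
      have b\<epsilon>: "(a n * y + penalty (X n) w) powr (- \<alpha>) \<le> \<epsilon> n" for w :: "int^'n"
        unfolding \<epsilon>_def using b elim(2) \<alpha> by (intro powr_mono2') auto
      have pen: "penalty (X n) z = a n * c n"
        using penalty_eq_scaled_penalty[OF elim(1), of z q] l1_norm_lattice_point[OF sc(2), of x]
        by (simp add: a_def c_def R_def z_def)
      have uv: "a n * y + penalty (X n) z = a n * (y + c n)"
          "a n * (y + \<delta> n) + penalty (X n) z = a n * (y + c n + \<delta> n)"
        by (simp_all add: pen algebra_simps)
      have yc: "0 < y + c n"
        using b1[of z] sc(1) unfolding uv by (smt (verit) mult_nonneg_nonpos)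
      have le: "a n * (y + c n) \<le> a n * (y + c n + \<delta> n)"
        using sc(1) \<delta>(1)[of n] by (intro mult_left_mono) auto
      have scale: "a n powr (- \<alpha>) = 1 / R n ^ CARD('n)"
        unfolding a_def R_def q_def by (rule height_scale_powr[OF \<alpha>(1) elim(1)])
      have "R n ^ CARD('n) * (((a n * (y + c n)) powr (- \<alpha>) - (a n * (y + c n + \<delta> n)) powr (- \<alpha>)) * exp (- (enn2real (S n) / (1 - \<epsilon> n))))
          \<le> R n ^ CARD('n) * prob (isolated_event (X n) (a n) (\<delta> n) z y)"
        unfolding isolated_event_def uv
        using b1[of z] b1 b\<epsilon> le elim(4,5) sc(2) unfolding uv
        by (intro mult_left_mono[OF prob_isolated_ge]) (auto simp: S_def less_top)
      moreover have diff: "(a n * (y + c n)) powr (- \<alpha>) - (a n * (y + c n + \<delta> n)) powr (- \<alpha>)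
          = 1 / R n ^ CARD('n) * ((y + c n) powr (- \<alpha>) - (y + c n + \<delta> n) powr (- \<alpha>))"
        using sc(1) yc \<delta>(1)[of n] by (simp add: powr_mult scale diff_divide_distrib)
      ultimately have m1: "((y + c n) powr (- \<alpha>) - (y + c n + \<delta> n) powr (- \<alpha>)) * exp (- (enn2real (S n) / (1 - \<epsilon> n)))
          \<le> R n ^ CARD('n) * prob (isolated_event (X n) (a n) (\<delta> n) z y)"
        unfolding diff using sc(2) by simp
      have m2: "\<delta> n * (\<alpha> * (y + c n + \<delta> n) powr (- (\<alpha> + 1))) * exp (- (enn2real (S n) / (1 - \<epsilon> n)))
          \<le> ((y + c n) powr (- \<alpha>) - (y + c n + \<delta> n) powr (- \<alpha>)) * exp (- (enn2real (S n) / (1 - \<epsilon> n)))"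
        using powr_diff_ge[OF yc \<delta>(1) \<alpha>(2)] by (intro mult_right_mono) auto
      have "\<delta> n * G n \<le> R n ^ CARD('n) * prob (isolated_event (X n) (a n) (\<delta> n) z y)"
        using order_trans[OF m2 m1] by (simp only: G_def mult_ac)
      then have "G n \<le> R n ^ CARD('n) * (prob (isolated_event (X n) (a n) (\<delta> n) z y) / \<delta> n)"
        using \<delta>(1)[of n] by (simp add: pos_le_divide_eq mult.commute)
      then show ?case
        unfolding a_def R_def z_def by (intro ennreal_leI mult_left_mono s)
    qed
  qed
  ultimately show ?thesis by (rule tendsto_le_liminf_ennreal)
qed

lemma nn_integral_discrete:
  fixes Y :: "'w \<Rightarrow> int^'n" and h :: "int^'n \<Rightarrow> ennreal"
  assumes [measurable]: "Y \<in> M \<rightarrow>\<^sub>M count_space UNIV"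
  shows "(\<integral>\<^sup>+\<omega>. h (Y \<omega>) \<partial>M) = (\<integral>\<^sup>+z. h z * ennreal (prob {\<omega> \<in> space M. Y \<omega> = z}) \<partial>count_space UNIV)"
proof -
  have "distr M (count_space UNIV) Y = density (count_space UNIV) (\<lambda>z. ennreal (prob {\<omega> \<in> space M. Y \<omega> = z}))"
  proof (rule measure_eqI_countable[where A = UNIV])
    fix z :: "int^'n"
    have "Y -` {z} \<inter> space M = {\<omega> \<in> space M. Y \<omega> = z}" by auto
    then show "emeasure (distr M (count_space UNIV) Y) {z}
        = emeasure (density (count_space UNIV) (\<lambda>z. ennreal (prob {\<omega> \<in> space M. Y \<omega> = z}))) {z}"
      by (simp add: emeasure_distr emeasure_density emeasure_eq_measure)
  qed (auto intro: countableI_type)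
  then have "(\<integral>\<^sup>+z. h z \<partial>distr M (count_space UNIV) Y)
      = (\<integral>\<^sup>+z. h z \<partial>density (count_space UNIV) (\<lambda>z. ennreal (prob {\<omega> \<in> space M. Y \<omega> = z})))"
    by simp
  then show ?thesis
    by (subst (asm) nn_integral_distr) (auto simp: nn_integral_density mult.commute)
qed

end

section \<open>Weak convergence of the maximiser\<close>

locale pareto_maximiser = pareto_field M \<xi> \<alpha>
  for M :: "'w measure" and \<xi> :: "int ^ 'n \<Rightarrow> 'w \<Rightarrow> real" and \<alpha> :: real +
  fixes Z :: "real \<Rightarrow> 'w \<Rightarrow> int ^ 'n"
  assumes measurable_maximiser: "0 < t \<Longrightarrow> Z t \<in> M \<rightarrow>\<^sub>M count_space UNIV"
    and maximiser: "0 < t \<Longrightarrow> AE \<omega> in M. is_arg_max (Psi t (\<lambda>z. \<xi> z \<omega>)) (\<lambda>_. True) (Z t \<omega>)"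
begin

text \<open>Fatou's lemma over the heights \<open>y\<close>, with windows of width \<open>\<delta>\<close> shrinking to zero.\<close>

lemma marginal_density_le_liminf:
  fixes X s :: "nat \<Rightarrow> real" and x :: "real^'n"
  defines "q \<equiv> q_const CARD('n) \<alpha>"
  assumes X: "filterlim X at_top sequentially" and s: "\<And>n. 0 \<le> s n" "s \<longlonglongrightarrow> s'"
  shows "(\<integral>\<^sup>+y\<in>{0<..}. ennreal (s' * joint_density \<alpha> x y) \<partial>lborel)
    \<le> liminf (\<lambda>n. ennreal (s n * (space_scale q (X n) ^ CARD('n)
        * prob {\<omega> \<in> space M. Z (X n) \<omega> = lattice_floor (space_scale q (X n)) x})))"
proof -
  define \<delta> :: "nat \<Rightarrow> real" where "\<delta> n = 1 / Suc n" for n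
  define R where "R n = space_scale q (X n)" for n
  define F where "F n y = prob (isolated_event (X n) (height_scale q (X n)) (\<delta> n) (lattice_floor (R n) x) y) / \<delta> n"
    for n y
  have \<delta>: "0 < \<delta> n" "\<delta> \<longlonglongrightarrow> 0" for n
    using LIMSEQ_inverse_real_of_nat by (simp_all add: \<delta>_def[abs_def] inverse_eq_divide)
  have [measurable]: "F n \<in> borel_measurable borel" for n
    unfolding F_def by measurable
  have "(\<integral>\<^sup>+y\<in>{0<..}. ennreal (s' * joint_density \<alpha> x y) \<partial>lborel)
      \<le> (\<integral>\<^sup>+y. liminf (\<lambda>n. ennreal (s n * (R n ^ CARD('n) * F n y)) * indicator {0<..} y) \<partial>lborel)"
  proof (intro nn_integral_mono)
    fix y :: real
    show "ennreal (s' * joint_density \<alpha> x y) * indicator {0<..} y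
        \<le> liminf (\<lambda>n. ennreal (s n * (R n ^ CARD('n) * F n y)) * indicator {0<..} y)"
    proof (cases "0 < y")
      case True
      show ?thesis
        using joint_density_le_liminf[OF X True \<delta> s, of x] True
        by (simp add: F_def R_def q_def)
    qed simp
  qed
  also have "\<dots> \<le> liminf (\<lambda>n. \<integral>\<^sup>+y. ennreal (s n * (R n ^ CARD('n) * F n y)) * indicator {0<..} y \<partial>lborel)"
    by (rule nn_integral_liminf) measurable
  also have "\<dots> \<le> liminf (\<lambda>n. ennreal (s n * (R n ^ CARD('n) * prob {\<omega> \<in> space M. Z (X n) \<omega> = lattice_floor (R n) x})))"
  proof (rule Liminf_mono)
    have "\<forall>\<^sub>F n in sequentially. 1 < X n"
      using X by (simp add: filterlim_at_top_dense)
    then show "\<forall>\<^sub>F n in sequentially. (\<integral>\<^sup>+y. ennreal (s n * (R n ^ CARD('n) * F n y)) * indicator {0<..} y \<partial>lborel)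
        \<le> ennreal (s n * (R n ^ CARD('n) * prob {\<omega> \<in> space M. Z (X n) \<omega> = lattice_floor (R n) x}))"
    proof eventually_elim
      case (elim n)
      note sc = scales_pos[OF elim, of q]
      have sR: "0 \<le> s n * R n ^ CARD('n)" using s(1)[of n] sc by (simp add: R_def)
      have "(\<integral>\<^sup>+y. ennreal (s n * (R n ^ CARD('n) * F n y)) * indicator {0<..} y \<partial>lborel)
          = ennreal (s n * R n ^ CARD('n)) * (\<integral>\<^sup>+y\<in>{0<..}. ennreal (F n y) \<partial>lborel)"
        using sR by (subst nn_integral_cmult[symmetric])
          (auto intro!: nn_integral_cong simp: ennreal_mult' mult.assoc[symmetric] simp del: mult.assoc)
      also have "\<dots> \<le> ennreal (s n * R n ^ CARD('n)) * ennreal (prob {\<omega> \<in> space M. Z (X n) \<omega> = lattice_floor (R n) x})"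
        unfolding F_def using elim sc \<delta>(1)
        by (intro mult_left_mono nn_integral_isolated_le_prob_maximiser measurable_maximiser maximiser) auto
      also have "\<dots> = ennreal (s n * (R n ^ CARD('n) * prob {\<omega> \<in> space M. Z (X n) \<omega> = lattice_floor (R n) x}))"
        using sR by (simp add: ennreal_mult' mult.assoc flip: ennreal_mult')
      finally show ?case .
    qed
  qed
  finally show ?thesis unfolding R_def .
qed

text \<open>Fatou's lemma over space: the expectation of a function of the rescaled maximiser is the integral over
  lattice cells of the function times the local density \<open>r ^ d * P (Z = \<lfloor>r *\<^sub>R x\<rfloor>)\<close>.\<close>

lemma expectation_limit_le_liminf:
  fixes X :: "nat \<Rightarrow> real" and f :: "real^'n \<Rightarrow> real"
  defines "q \<equiv> q_const CARD('n) \<alpha>"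
  assumes X: "filterlim X at_top sequentially" and f: "continuous_on UNIV f" "\<And>x. 0 \<le> f x"
  shows "(\<integral>\<^sup>+x. ennreal (f x) \<partial>density lborel (\<lambda>x. ennreal (limit_density \<alpha> x)))
    \<le> liminf (\<lambda>n. \<integral>\<^sup>+\<omega>. ennreal (f ((1 / space_scale q (X n)) *\<^sub>R of_int_vec (Z (X n) \<omega>))) \<partial>M)"
proof -
  have q: "0 < q" using exponent_gt by (simp add: q_def q_const_pos)
  have [measurable]: "f \<in> borel_measurable borel"
    using f(1) by (rule borel_measurable_continuous_onI)
  define R where "R n = space_scale q (X n)" for n
  define h where "h n z = ennreal (f ((1 / R n) *\<^sub>R of_int_vec z)
      * (R n ^ CARD('n) * prob {\<omega> \<in> space M. Z (X n) \<omega> = z}))" for n and z :: "int^'n"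
  have R_lim: "filterlim R at_top sequentially"
    unfolding R_def by (rule filterlim_compose[OF filterlim_space_scale[OF q] X])
  have "(\<integral>\<^sup>+x. ennreal (f x) \<partial>density lborel (\<lambda>x. ennreal (limit_density \<alpha> x)))
      = (\<integral>\<^sup>+x. ennreal (limit_density \<alpha> x) * ennreal (f x) \<partial>lborel)"
    by (subst nn_integral_density) auto
  also have "\<dots> = (\<integral>\<^sup>+x. (\<integral>\<^sup>+y\<in>{0<..}. ennreal (f x * joint_density \<alpha> x y) \<partial>lborel) \<partial>lborel)"
  proof (rule nn_integral_cong_AE)
    show "AE x in lborel. ennreal (limit_density \<alpha> x) * ennreal (f x)
        = (\<integral>\<^sup>+y\<in>{0<..}. ennreal (f x * joint_density \<alpha> x y) \<partial>lborel)"
      using AE_limit_density[OF exponent_gt]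
    proof eventually_elim
      case (elim x)
      have "(\<integral>\<^sup>+y\<in>{0<..}. ennreal (f x * joint_density \<alpha> x y) \<partial>lborel)
          = (\<integral>\<^sup>+y. ennreal (f x) * (ennreal (joint_density \<alpha> x y) * indicator {0<..} y) \<partial>lborel)"
        using f(2) by (simp add: ennreal_mult' mult.assoc)
      also have "\<dots> = ennreal (f x) * ennreal (limit_density \<alpha> x)"
        unfolding elim by (rule nn_integral_cmult) measurable
      finally show ?case by (simp add: mult.commute)
    qed
  qed
  also have "\<dots> \<le> (\<integral>\<^sup>+x. liminf (\<lambda>n. h n (lattice_floor (R n) x)) \<partial>lborel)"
  proof (intro nn_integral_mono)
    fix x :: "real^'n"
    have "(\<lambda>n. f (lattice_point (R n) x)) \<longlonglongrightarrow> f x"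
      using continuous_on_tendsto_compose[OF f(1) lattice_point_tendsto[OF R_lim]] by simp
    from marginal_density_le_liminf[OF X f(2) this, of x]
    show "(\<integral>\<^sup>+y\<in>{0<..}. ennreal (f x * joint_density \<alpha> x y) \<partial>lborel) \<le> liminf (\<lambda>n. h n (lattice_floor (R n) x))"
      by (simp add: h_def R_def q_def lattice_point_def)
  qed
  also have "\<dots> \<le> liminf (\<lambda>n. \<integral>\<^sup>+x. h n (lattice_floor (R n) x) \<partial>lborel)"
    by (rule nn_integral_liminf) measurable
  also have "\<dots> \<le> liminf (\<lambda>n. \<integral>\<^sup>+\<omega>. ennreal (f ((1 / R n) *\<^sub>R of_int_vec (Z (X n) \<omega>))) \<partial>M)"
  proof (rule Liminf_mono)
    have "\<forall>\<^sub>F n in sequentially. 1 < X n"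
      using X by (simp add: filterlim_at_top_dense)
    then show "\<forall>\<^sub>F n in sequentially. (\<integral>\<^sup>+x. h n (lattice_floor (R n) x) \<partial>lborel)
        \<le> (\<integral>\<^sup>+\<omega>. ennreal (f ((1 / R n) *\<^sub>R of_int_vec (Z (X n) \<omega>))) \<partial>M)"
    proof eventually_elim
      case (elim n)
      have R: "0 < R n" using scales_pos[OF elim] by (simp add: R_def)
      have [measurable]: "Z (X n) \<in> M \<rightarrow>\<^sub>M count_space UNIV"
        using elim by (intro measurable_maximiser) auto
      have "(\<integral>\<^sup>+x. h n (lattice_floor (R n) x) \<partial>lborel)
          = (\<integral>\<^sup>+z. ennreal (1 / R n ^ CARD('n)) * h n z \<partial>count_space UNIV)"
        using R by (simp add: nn_integral_lattice_floor nn_integral_cmult)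
      also have "\<dots> = (\<integral>\<^sup>+z. ennreal (f ((1 / R n) *\<^sub>R of_int_vec z)) * ennreal (prob {\<omega> \<in> space M. Z (X n) \<omega> = z}) \<partial>count_space UNIV)"
        using R f(2) by (intro nn_integral_cong) (simp add: h_def flip: ennreal_mult)
      also have "\<dots> = (\<integral>\<^sup>+\<omega>. ennreal (f ((1 / R n) *\<^sub>R of_int_vec (Z (X n) \<omega>))) \<partial>M)"
        by (rule nn_integral_discrete[symmetric]) measurable
      finally show ?case by simp
    qed
  qed
  finally show ?thesis unfolding R_def .
qed

text \<open>Adding a constant makes a bounded function nonnegative and changes both sides by the same amount,
  because the limit law is a probability measure.\<close>

lemma expectation_lower_bound:
  fixes X :: "nat \<Rightarrow> real" and f :: "real^'n \<Rightarrow> real"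
  defines "q \<equiv> q_const CARD('n) \<alpha>"
  assumes X: "filterlim X at_top sequentially" and f: "continuous_on UNIV f" "\<And>x. \<bar>f x\<bar> \<le> B"
    and e: "e < (\<integral>x. f x \<partial>density lborel (\<lambda>x. ennreal (limit_density \<alpha> x)))"
  shows "\<forall>\<^sub>F n in sequentially. e < (\<integral>\<omega>. f ((1 / space_scale q (X n)) *\<^sub>R of_int_vec (Z (X n) \<omega>)) \<partial>M)"
proof -
  let ?P = "density lborel (\<lambda>x :: real^'n. ennreal (limit_density \<alpha> x))"
  let ?Y = "\<lambda>n \<omega>. (1 / space_scale q (X n)) *\<^sub>R of_int_vec (Z (X n) \<omega>)"
  interpret P: prob_space ?P by (rule prob_space_limit_density[OF exponent_gt])
  have [measurable]: "f \<in> borel_measurable borel"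
    using f(1) by (rule borel_measurable_continuous_onI)
  have B: "0 \<le> B" using f(2)[of 0] by linarith
  have pos: "0 \<le> B + 1 + f x" for x using f(2)[of x] by (simp add: abs_le_iff)
  have int_P: "integrable ?P f"
    using f(2) by (intro P.integrable_const_bound[where B = B]) auto
  have "0 \<le> B + (\<integral>x. f x \<partial>?P)"
  proof -
    have "norm (\<integral>x. f x \<partial>?P) \<le> (\<integral>x. B \<partial>?P)"
      using f(2) by (intro Bochner_Integration.integral_norm_bound_integral[THEN order_trans] int_P) auto
    then show ?thesis by (simp add: P.prob_space[simplified])
  qed
  \<comment> \<open>The extra summand one makes the right-hand side positive, so that truncating negative numbers to zero preserves
     the strict inequality, whatever the sign of \<open>B + 1 + e\<close>.\<close>
  then have "ennreal (B + 1 + e) < ennreal (B + 1 + (\<integral>x. f x \<partial>?P))"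
    using e by (intro ennreal_lessI) auto
  also have "ennreal (B + 1 + (\<integral>x. f x \<partial>?P)) = (\<integral>\<^sup>+x. ennreal (B + 1 + f x) \<partial>?P)"
    using int_P pos by (subst nn_integral_eq_integral) (auto simp: P.prob_space[simplified])
  also have "\<dots> \<le> liminf (\<lambda>n. \<integral>\<^sup>+\<omega>. ennreal (B + 1 + f (?Y n \<omega>)) \<partial>M)"
    unfolding q_def using pos f(1) by (intro expectation_limit_le_liminf X continuous_intros)
  finally have "\<forall>\<^sub>F n in sequentially. ennreal (B + 1 + e) < (\<integral>\<^sup>+\<omega>. ennreal (B + 1 + f (?Y n \<omega>)) \<partial>M)"
    by (rule less_LiminfD)
  moreover have "\<forall>\<^sub>F n in sequentially. 0 < X n"
    using X by (simp add: filterlim_at_top_dense)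
  ultimately show ?thesis
  proof eventually_elim
    case (elim n)
    have [measurable]: "Z (X n) \<in> M \<rightarrow>\<^sub>M count_space UNIV"
      using elim by (intro measurable_maximiser) auto
    have "integrable M (\<lambda>\<omega>. f (?Y n \<omega>))"
      using f(2) by (intro integrable_const_bound[where B = B]) auto
    then have "(\<integral>\<^sup>+\<omega>. ennreal (B + 1 + f (?Y n \<omega>)) \<partial>M) = ennreal (B + 1 + (\<integral>\<omega>. f (?Y n \<omega>) \<partial>M))"
      using pos by (subst nn_integral_eq_integral) (auto simp: prob_space)
    with elim(1) show ?case
      using ennreal_leI[of "B + 1 + (\<integral>\<omega>. f (?Y n \<omega>) \<partial>M)" "B + 1 + e"] by (auto simp: not_le[symmetric])
  qed
qed

lemma weakly_converges_maximiser:
  "weakly_converges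
    (\<lambda>t. distr M borel (\<lambda>\<omega>. (ln t / t) powr (q_const CARD('n) \<alpha> + 1) *\<^sub>R of_int_vec (Z t \<omega>)))
    (density lborel (\<lambda>x :: real ^ 'n. ennreal (limit_density \<alpha> x))) at_top"
  unfolding weakly_converges_def
proof (intro allI impI tendsto_at_topI_sequentially)
  fix f :: "real^'n \<Rightarrow> real" and X :: "nat \<Rightarrow> real"
  assume f: "continuous_on UNIV f" "bounded (range f)" and X: "filterlim X at_top sequentially"
  let ?q = "q_const CARD('n) \<alpha>"
  let ?P = "density lborel (\<lambda>x :: real^'n. ennreal (limit_density \<alpha> x))"
  let ?E = "\<lambda>f n. \<integral>\<omega>. f ((1 / space_scale ?q (X n)) *\<^sub>R of_int_vec (Z (X n) \<omega>)) \<partial>M :: real"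
  have [measurable]: "f \<in> borel_measurable borel"
    using f(1) by (rule borel_measurable_continuous_onI)
  obtain B where B: "\<And>x. \<bar>f x\<bar> \<le> B" using f(2) by (auto simp: bounded_iff)
  have "?E f \<longlonglongrightarrow> (\<integral>x. f x \<partial>?P)"
  proof (rule order_tendstoI)
    fix e assume "e < (\<integral>x. f x \<partial>?P)"
    then show "\<forall>\<^sub>F n in sequentially. e < ?E f n"
      using B f(1) by (intro expectation_lower_bound X)
  next
    fix e assume "(\<integral>x. f x \<partial>?P) < e"
    then have "- e < (\<integral>x. - f x \<partial>?P)" by simp
    then have "\<forall>\<^sub>F n in sequentially. - e < ?E (\<lambda>x. - f x) n"
      using B f(1) by (intro expectation_lower_bound X continuous_intros) auto
    then show "\<forall>\<^sub>F n in sequentially. ?E f n < e" by simp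
  qed
  moreover have "\<forall>\<^sub>F n in sequentially. ?E f n
      = (\<integral>x. f x \<partial>distr M borel (\<lambda>\<omega>. (ln (X n) / X n) powr (?q + 1) *\<^sub>R of_int_vec (Z (X n) \<omega>)))"
  proof -
    have "\<forall>\<^sub>F n in sequentially. 1 < X n"
      using X by (simp add: filterlim_at_top_dense)
    then show ?thesis
    proof eventually_elim
      case (elim n)
      have [measurable]: "Z (X n) \<in> M \<rightarrow>\<^sub>M count_space UNIV"
        using elim by (intro measurable_maximiser) auto
      have "1 / space_scale ?q (X n) = (ln (X n) / X n) powr (?q + 1)"
        using elim by (simp add: space_scale_def powr_divide)
      then show ?case by (subst integral_distr) auto
    qed
  qed
  ultimately show "(\<lambda>n. \<integral>x. f x \<partial>distr M borel (\<lambda>\<omega>. (ln (X n) / X n) powr (?q + 1) *\<^sub>R of_int_vec (Z (X n) \<omega>)))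
      \<longlonglongrightarrow> (\<integral>x. f x \<partial>?P)"
    by (rule Lim_transform_eventually)
qed

end

theorem theorem2:
  fixes M :: "'w measure"
    and \<xi> :: "int ^ 'n \<Rightarrow> 'w \<Rightarrow> real"
    and \<alpha> :: real
    and Z :: "real \<Rightarrow> 'w \<Rightarrow> int ^ 'n"
  assumes "prob_space M"
    and "\<alpha> > real CARD('n)"
    and "prob_space.indep_vars M (\<lambda>_. borel) \<xi> UNIV"
    and "\<And>z x. x \<ge> 1 \<Longrightarrow> measure M {\<omega> \<in> space M. \<xi> z \<omega> \<le> x} = 1 - x powr (- \<alpha>)"
    and "\<And>t. t > 0 \<Longrightarrow> Z t \<in> measurable M (count_space UNIV)"
    and "\<And>t. t > 0 \<Longrightarrow>
           AE \<omega> in M. is_arg_max (Psi t (\<lambda>z. \<xi> z \<omega>)) (\<lambda>_. True) (Z t \<omega>)"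
  shows "prob_space (density lborel (\<lambda>x :: real ^ 'n. ennreal (limit_density \<alpha> x)))
    \<and> weakly_converges
          (\<lambda>t. distr M borel
             (\<lambda>\<omega>. (ln t / t) powr (q_const CARD('n) \<alpha> + 1) *\<^sub>R of_int_vec (Z t \<omega>)))
          (density lborel (\<lambda>x :: real ^ 'n. ennreal (limit_density \<alpha> x)))
          at_top"
proof -
  interpret prob_space M by fact
  interpret pareto_maximiser M \<xi> \<alpha> Z
    by unfold_locales (use assms in auto)
  show ?thesis
    using prob_space_limit_density[OF exponent_gt] weakly_converges_maximiser by blast
qed

end
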